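(* Let $t\ge 2$ be an integer and define $\delta(t)$ as below. Then for every $\alpha\in(0,1]$ and every election $(V,A,\succ)$ with $|A|\ge t$, there exists a $(t,\alpha)$-undominated set $C\subseteq A$ with $|C|\le \lfloor \delta(t)\cdot t/\alpha\rfloor$. Moreover $1<\delta(t)\le 4.75$ for every integer $t\ge2$, and $\delta(t)\to 1$ as $t\to\infty$.
   Context: An election $(V,A,\succ)$: finite nonempty voter set $V$ with $n=|V|$, finite candidate set $A$, and for each voter $v$ a strict linear order $\succ_v$ on $A$. For an integer $t\ge1$, a voter $v$, a set $C\subseteq A$ with $|C|\ge t$ and $a\in A\setminus C$: $C\succ_v^t a$ iff $|\{c\in C: c\succ_v a\}|\ge t$; otherwise we write $a\succ_v^t C$. A set $C\subseteq A$ is $(t,\alpha)$-undominated if $|C|\ge t$ and for every $a\in A\setminus C$, $|\{v\in V: a\succ_v^t C\}|\le\lfloor\alpha n\rfloor$. For $\gamma\ge1$ and integer $t\ge2$ let $$\omega(\gamma,t)=\left(\frac{e^{-\frac{\gamma t-t+1}{\gamma t}}}{\left(\frac{t-1}{\gamma t}\right)^{\frac{t-1}{\gamma t}}}\right)^{\gamma t}.$$ For $\alpha\in(0,1]$ let $$s_1(\alpha,t)=\inf\Big\{\tfrac{\gamma\tau}{\tau-1}\cdot\tfrac{1}{1-\omega(\gamma,t)\tau}\cdot\tfrac{t}{\alpha}+\log_\tau\!\Big(\tfrac{1}{1-\omega(\gamma,t)\tau}\cdot\tfrac1\alpha\Big)\ :\ \gamma\ge1,\ \tau>1,\ \tau\,\omega(\gamma,t)<1\Big\},$$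 $$s_2(\alpha,t)=\inf\Big\{B\in\mathbb{N}\ :\ \exists\gamma\ge1 \text{ with } \alpha\ge \tfrac{\gamma t}{B}+\omega(\gamma,t)\Big\},$$ and $\delta(t)=\sup_{\alpha\in(0,1]}\min\Big\{\tfrac{\alpha\, s_1(\alpha,t)}{t},\tfrac{\alpha\, s_2(\alpha,t)}{t}\Big\}$. *)

theory Defs
  imports "HOL-Analysis.Analysis"
begin

text \<open>An election (V, A, pref): V finite nonempty set of voters, A finite set of candidates,
  and for each voter v a strict linear order pref v on A ((c, a) \<in> pref v means c is
  preferred to a by v).\<close>
definition election :: "'v set \<Rightarrow> 'a set \<Rightarrow> ('v \<Rightarrow> ('a \<times> 'a) set) \<Rightarrow> bool" where
  "election V A pref \<longleftrightarrow> finite V \<and> V \<noteq> {} \<and> finite A \<and>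
     (\<forall>v\<in>V. strict_linear_order_on A (pref v) \<and> pref v \<subseteq> A \<times> A)"

definition t_beats :: "('v \<Rightarrow> ('a \<times> 'a) set) \<Rightarrow> nat \<Rightarrow> 'v \<Rightarrow> 'a set \<Rightarrow> 'a \<Rightarrow> bool" where
  "t_beats pref t v C a \<longleftrightarrow> card {c \<in> C. (c, a) \<in> pref v} \<ge> t"

definition undominated ::
  "'v set \<Rightarrow> 'a set \<Rightarrow> ('v \<Rightarrow> ('a \<times> 'a) set) \<Rightarrow> nat \<Rightarrow> real \<Rightarrow> 'a set \<Rightarrow> bool" where
  "undominated V A pref t \<alpha> C \<longleftrightarrow> C \<subseteq> A \<and> card C \<ge> t \<and>
     (\<forall>a \<in> A - C. real (card {v \<in> V. \<not> t_beats pref t v C a}) \<le> of_int \<lfloor>\<alpha> * real (card V)\<rfloor>)"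

definition omega :: "real \<Rightarrow> nat \<Rightarrow> real" where
  "omega \<gamma> t = (exp (- ((\<gamma> * real t - real t + 1) / (\<gamma> * real t))) /
                 (((real t - 1) / (\<gamma> * real t)) powr ((real t - 1) / (\<gamma> * real t))))
                 powr (\<gamma> * real t)"

definition s1 :: "real \<Rightarrow> nat \<Rightarrow> real" where
  "s1 \<alpha> t = Inf {(\<gamma> * \<tau> / (\<tau> - 1)) * (1 / (1 - omega \<gamma> t * \<tau>)) * (t / \<alpha>)
                  + log \<tau> ((1 / (1 - omega \<gamma> t * \<tau>)) * (1 / \<alpha>)) | \<gamma> \<tau>.
                 \<gamma> \<ge> 1 \<and> \<tau> > 1 \<and> \<tau> * omega \<gamma> t < 1}"

text \<open>B ranges over the positive naturals (B = 0 would make gamma t / B meaningless).\<close>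
definition s2 :: "real \<Rightarrow> nat \<Rightarrow> real" where
  "s2 \<alpha> t = real (Inf {B :: nat. B \<ge> 1 \<and> (\<exists>\<gamma> \<ge> 1. \<alpha> \<ge> \<gamma> * t / B + omega \<gamma> t)})"

definition delta :: "nat \<Rightarrow> real" where
  "delta t = (SUP \<alpha> \<in> {0<..1}. min (\<alpha> * s1 \<alpha> t / t) (\<alpha> * s2 \<alpha> t / t))"

end

theory Submission
  imports Defs
begin

text \<open>
  Let every voter pay a price for exactly those candidates \<open>a\<close> for which the mass of the
  candidates weakly preferred to \<open>a\<close> is still below \<open>u\<close>. In an equilibrium of these prices on
  the cube, which Sperner's lemma provides, the payments bound the total mass by \<open>B\<close>, and every
  candidate not taken entirely is wanted by at most \<open>u n / B\<close> voters. Rounding the fractional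
  solution by transfers between pairs of coordinates, along which the Chernoff moment estimate is
  concave, yields a committee that fails only an \<open>\<omega>\<close>-fraction of the voters. One round gives
  \<open>s\<^sub>2\<close>; repeating the argument on the failed voters with budgets decreasing by the factor \<open>\<tau>\<close>
  gives \<open>s\<^sub>1\<close>. The bound 4.75 comes from \<open>s\<^sub>1\<close> with \<open>\<gamma> = 7/2\<close>, \<open>\<tau> = 8\<close> for \<open>\<alpha> \<le> 1/16\<close> and from
  \<open>s\<^sub>2\<close> with \<open>\<gamma> = 4\<close> otherwise, and the limit from \<open>s\<^sub>1\<close> with \<open>\<gamma>\<close> near 1 and \<open>\<tau>\<close> large.
\<close>

section \<open>Fractional equilibrium\<close>

text \<open>Kuhn's labelling lemma, a form of Sperner's, yields a grid cell in which every
  coordinate has two corners \<open>r\<close> and \<open>s\<close> with different labels. As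
  \<open>L\<close> is antitone, the large load at \<open>r\<close> passes down to the bottom corner
  \<open>q\<close>, and the small load at \<open>s\<close> passes up to the top corner.\<close>

lemma antimono_grid_equilibrium:
  fixes A :: "'a set" and L :: "('a \<Rightarrow> nat) \<Rightarrow> 'a \<Rightarrow> real" and p :: nat
  assumes fin: "finite A" and p: "0 < p"
    and anti: "\<And>x y a. a \<in> A \<Longrightarrow> (\<And>c. c \<in> A \<Longrightarrow> x c \<le> y c) \<Longrightarrow> L y a \<le> L x a"
  obtains q where "\<And>a. a \<in> A \<Longrightarrow> q a < p"
    and "\<And>a. a \<in> A \<Longrightarrow> q a = 0 \<or> 1 < L q a"
    and "\<And>a. a \<in> A \<Longrightarrow> Suc (q a) = p \<or> L (\<lambda>c. Suc (q c)) a \<le> 1"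
proof -
  define n where "n = card A"
  obtain e where e: "bij_betw e {..<n} A"
    using ex_bij_betw_nat_finite[OF fin] by (auto simp: n_def atLeast0LessThan)
  define idx where "idx = inv_into {..<n} e"
  have idx: "idx a < n" "e (idx a) = a" if "a \<in> A" for a
    using that e inv_into_into[of a e "{..<n}"] f_inv_into_f[of a e "{..<n}"]
    by (auto simp: idx_def bij_betw_def)
  have eA: "e i \<in> A" "idx (e i) = i" if "i < n" for i
    using that e by (auto simp: idx_def bij_betw_def)
  \<comment> \<open>Label 0 asks for a higher price. The values at \<open>x i = 0\<close> and
    \<open>x i = p\<close> are the boundary labels that \<open>kuhn_lemma\<close> demands.\<close>
  define lab :: "(nat \<Rightarrow> nat) \<Rightarrow> nat \<Rightarrow> nat" where
    "lab x i = (if x i = 0 \<or> x i < p \<and> 1 < L (\<lambda>a. x (idx a)) (e i) then 0 else 1)" for x i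
  obtain q where q: "\<forall>i<n. q i < p"
    and rs: "\<forall>i<n. \<exists>r s. (\<forall>j<n. q j \<le> r j \<and> r j \<le> q j + 1) \<and>
       (\<forall>j<n. q j \<le> s j \<and> s j \<le> q j + 1) \<and> lab r i \<noteq> lab s i"
    by (rule kuhn_lemma[of p n lab]) (use p in \<open>auto simp: lab_def\<close>)
  have main: "(q i = 0 \<or> 1 < L (\<lambda>a. q (idx a)) (e i)) \<and>
      (Suc (q i) = p \<or> L (\<lambda>a. Suc (q (idx a))) (e i) \<le> 1)" if i: "i < n" for i
  proof -
    obtain r s where r: "\<forall>j<n. q j \<le> r j \<and> r j \<le> q j + 1"
      and s: "\<forall>j<n. q j \<le> s j \<and> s j \<le> q j + 1"
      and lab: "lab r i = 0" "lab s i = 1"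
    proof -
      obtain r s where *: "\<forall>j<n. q j \<le> r j \<and> r j \<le> q j + 1"
        "\<forall>j<n. q j \<le> s j \<and> s j \<le> q j + 1" "lab r i \<noteq> lab s i"
        using rs i by blast
      show ?thesis
      proof (cases "lab r i = 0")
        case True
        then show ?thesis using * by (intro that[of r s]) (auto simp: lab_def split: if_splits)
      next
        case False
        then show ?thesis using * by (intro that[of s r]) (auto simp: lab_def split: if_splits)
      qed
    qed
    have 1: "L (\<lambda>a. r (idx a)) (e i) \<le> L (\<lambda>a. q (idx a)) (e i)"
      by (rule anti) (use r idx eA i in auto)
    have 2: "L (\<lambda>a. Suc (q (idx a))) (e i) \<le> L (\<lambda>a. s (idx a)) (e i)"
      by (rule anti) (use s idx eA i in auto)
    have "q i = 0 \<or> 1 < L (\<lambda>a. q (idx a)) (e i)"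
      using lab(1) 1 r i by (auto simp: lab_def split: if_splits)
    moreover have "Suc (q i) = p \<or> L (\<lambda>a. Suc (q (idx a))) (e i) \<le> 1"
    proof (cases "s i < p")
      case True
      then show ?thesis using lab(2) 2 by (auto simp: lab_def split: if_splits)
    next
      \<comment> \<open>Label 1 on the far face says nothing about \<open>L\<close>, but then
        \<open>q i\<close> is the last value below \<open>p\<close>.\<close>
      case False
      then have "p \<le> s i" "s i \<le> q i + 1" "q i < p" using s q i by auto
      then show ?thesis by linarith
    qed
    ultimately show ?thesis by blast
  qed
  show ?thesis
  proof (rule that[of "\<lambda>a. q (idx a)"])
    fix a assume a: "a \<in> A"
    show "q (idx a) < p" using q idx a by auto
    show "q (idx a) = 0 \<or> 1 < L (\<lambda>a. q (idx a)) a"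
      using main[of "idx a"] idx[OF a] by auto
    show "Suc (q (idx a)) = p \<or> L (\<lambda>c. Suc (q (idx c))) a \<le> 1"
      using main[of "idx a"] idx[OF a] by auto
  qed
qed

section \<open>Initial segments of a linear order\<close>

definition weakly_preferred :: "('a \<times> 'a) set \<Rightarrow> 'a set \<Rightarrow> 'a \<Rightarrow> 'a set" where
  "weakly_preferred r A a = {c \<in> A. c = a \<or> (c, a) \<in> r}"

lemma weakly_preferred_linear:
  assumes "strict_linear_order_on A r" "a \<in> A" "b \<in> A"
  shows "weakly_preferred r A a \<subseteq> weakly_preferred r A b
       \<or> weakly_preferred r A b \<subseteq> weakly_preferred r A a"
proof -
  have tr: "trans r" and "a = b \<or> (a, b) \<in> r \<or> (b, a) \<in> r"
    using assms unfolding strict_linear_order_on_def total_on_def by blast+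
  moreover have "weakly_preferred r A a \<subseteq> weakly_preferred r A b" if "(a, b) \<in> r" for a b
    using that transD[OF tr _ that] by (auto simp: weakly_preferred_def)
  ultimately show ?thesis by blast
qed

text \<open>Initial segments form a chain, where least cardinality means least for
  inclusion.\<close>

lemma smallest_weakly_preferred:
  assumes fin: "finite A" and lin: "strict_linear_order_on A r"
    and S: "S \<subseteq> A" "S \<noteq> {}"
  obtains b where "b \<in> S" "\<And>a. a \<in> S \<Longrightarrow> weakly_preferred r A b \<subseteq> weakly_preferred r A a"
proof -
  obtain b where b: "b \<in> S"
    "\<And>a. a \<in> S \<Longrightarrow> card (weakly_preferred r A b) \<le> card (weakly_preferred r A a)"
    using ex_has_least_nat[of "\<lambda>b. b \<in> S" _ "\<lambda>b. card (weakly_preferred r A b)"] S(2) by blast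
  have "weakly_preferred r A b \<subseteq> weakly_preferred r A a" if a: "a \<in> S" for a
  proof (rule ccontr)
    assume n: "\<not> ?thesis"
    then have "weakly_preferred r A a \<subset> weakly_preferred r A b"
      using weakly_preferred_linear[OF lin, of a b] a b(1) S by auto
    moreover have "finite (weakly_preferred r A b)" using fin by (simp add: weakly_preferred_def)
    ultimately show False using psubset_card_mono b(2)[OF a] not_less by metis
  qed
  then show ?thesis using that b by blast
qed

lemma largest_weakly_preferred:
  assumes fin: "finite A" and lin: "strict_linear_order_on A r"
    and S: "S \<subseteq> A" "S \<noteq> {}"
  obtains b where "b \<in> S" "\<And>a. a \<in> S \<Longrightarrow> weakly_preferred r A a \<subseteq> weakly_preferred r A b"
proof -
  obtain k where k: "k \<in> S" using S(2) by blast
  have "card (weakly_preferred r A a) \<le> card A" for a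
    using fin by (intro card_mono) (auto simp: weakly_preferred_def)
  then obtain b where b: "b \<in> S"
    "\<And>a. a \<in> S \<Longrightarrow> card (weakly_preferred r A a) \<le> card (weakly_preferred r A b)"
    using ex_has_greatest_nat[of "\<lambda>b. b \<in> S" k "\<lambda>b. card (weakly_preferred r A b)" "Suc (card A)"] k
    by (auto simp: less_Suc_eq_le)
  have "weakly_preferred r A a \<subseteq> weakly_preferred r A b" if a: "a \<in> S" for a
  proof (rule ccontr)
    assume n: "\<not> ?thesis"
    then have "weakly_preferred r A b \<subset> weakly_preferred r A a"
      using weakly_preferred_linear[OF lin, of a b] a b(1) S by auto
    moreover have "finite (weakly_preferred r A a)" using fin by (simp add: weakly_preferred_def)
    ultimately show False using psubset_card_mono b(2)[OF a] not_less by metis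
  qed
  then show ?thesis using that b by blast
qed

text \<open>The candidates whose segment has mass below \<open>u\<close> all lie in the largest such
  segment, because each segment contains its own endpoint. This caps what a single voter
  pays.\<close>

lemma mass_below_threshold:
  fixes x :: "'a \<Rightarrow> real"
  assumes fin: "finite A" and lin: "strict_linear_order_on A r"
    and nn: "\<And>c. c \<in> A \<Longrightarrow> 0 \<le> x c" and u: "0 \<le> u"
  shows "sum x {c \<in> A. sum x (weakly_preferred r A c) < u} \<le> u"
proof (cases "{c \<in> A. sum x (weakly_preferred r A c) < u} = {}")
  case True
  then show ?thesis using u by (simp only: sum.empty)
next
  case False
  let ?S = "{c \<in> A. sum x (weakly_preferred r A c) < u}"
  obtain b where b: "b \<in> ?S"
    "\<And>a. a \<in> ?S \<Longrightarrow> weakly_preferred r A a \<subseteq> weakly_preferred r A b"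
    using largest_weakly_preferred[OF fin lin _ False] by blast
  have "?S \<subseteq> weakly_preferred r A b"
    using b(2) by (auto simp: weakly_preferred_def)
  then have "sum x ?S \<le> sum x (weakly_preferred r A b)"
    using fin nn by (intro sum_mono2) (auto simp: weakly_preferred_def)
  then show ?thesis using b(1) by auto
qed

text \<open>Prices live on the grid of mesh \<open>1 / p\<close>; a voter pays \<open>H\<close>
  times the price of each candidate whose segment has mass below \<open>u\<close>. At equilibrium
  every positive price is covered by payments, so adding up the payments voter by voter bounds the
  total price.\<close>

lemma fractional_core_approx:
  fixes A :: "'a set" and V :: "'v set" and u H \<epsilon> :: real
  assumes fin: "finite A" "finite V"
    and lin: "\<And>v. v \<in> V \<Longrightarrow> strict_linear_order_on A (pref v)"
    and pos: "0 < u" "0 < H" "0 < \<epsilon>"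
  obtains x :: "'a \<Rightarrow> real" where "\<And>a. a \<in> A \<Longrightarrow> 0 \<le> x a \<and> x a \<le> 1"
    and "sum x A \<le> H * u * card V + \<epsilon>"
    and "\<And>a. a \<in> A \<Longrightarrow> x a < 1 \<Longrightarrow>
           H * card {v \<in> V. sum x (weakly_preferred (pref v) A a) < u} \<le> 1"
proof -
  obtain p :: nat where p: "0 < p" "card A / \<epsilon> \<le> p"
  proof -
    obtain p :: nat where "card A / \<epsilon> \<le> p" using real_arch_simple by blast
    then show ?thesis by (intro that[of "Suc p"]) auto
  qed
  define N where "N q a = {v \<in> V. (\<Sum>c\<in>weakly_preferred (pref v) A a. real (q c) / p) < u}"
    for q :: "'a \<Rightarrow> nat" and a
  define L where "L q a = H * card (N q a)" for q a
  have finN: "finite (N q a)" for q a using fin by (simp add: N_def)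
  \<comment> \<open>Higher prices enlarge the masses, so fewer voters stay below
    \<open>u\<close>.\<close>
  have anti: "L y a \<le> L x a" if "a \<in> A" "\<And>c. c \<in> A \<Longrightarrow> x c \<le> y c" for x y a
  proof -
    have "(\<Sum>c\<in>weakly_preferred (pref v) A a. real (x c) / p) \<le>
          (\<Sum>c\<in>weakly_preferred (pref v) A a. real (y c) / p)" for v
      by (rule sum_mono) (use that in \<open>auto simp: weakly_preferred_def divide_right_mono\<close>)
    then have "N y a \<subseteq> N x a" unfolding N_def using le_less_trans by blast
    then show ?thesis unfolding L_def using pos finN by (intro mult_left_mono) (auto intro: card_mono)
  qed
  obtain q where q: "\<And>a. a \<in> A \<Longrightarrow> q a < p"
    "\<And>a. a \<in> A \<Longrightarrow> q a = 0 \<or> 1 < L q a"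
    "\<And>a. a \<in> A \<Longrightarrow> Suc (q a) = p \<or> L (\<lambda>c. Suc (q c)) a \<le> 1"
    by (rule antimono_grid_equilibrium[where L = L, OF fin(1) p(1) anti]) auto
  have "(\<Sum>a\<in>A. real (q a) / p) \<le> (\<Sum>a\<in>A. real (q a) / p * L q a)"
  proof (rule sum_mono)
    fix a assume "a \<in> A"
    then show "real (q a) / p \<le> real (q a) / p * L q a"
      using q(2)[of a] mult_left_mono[of 1 "L q a" "real (q a) / p"] by auto
  qed
  also have "\<dots> = (\<Sum>a\<in>A. \<Sum>v\<in>V. if v \<in> N q a then H * (real (q a) / p) else 0)"
  proof (rule sum.cong[OF refl])
    fix a
    have "V \<inter> N q a = N q a" by (auto simp: N_def)
    then show "real (q a) / p * L q a = (\<Sum>v\<in>V. if v \<in> N q a then H * (real (q a) / p) else 0)"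
      using sum.inter_restrict[OF fin(2), of "\<lambda>_. H * (real (q a) / p)" "N q a"]
      by (simp add: L_def mult_ac)
  qed
  \<comment> \<open>Regrouped by voter: each of them pays at most \<open>H * u\<close>.\<close>
  also have "\<dots> = (\<Sum>v\<in>V. \<Sum>a\<in>A. if v \<in> N q a then H * (real (q a) / p) else 0)"
    by (rule sum.swap)
  also have "\<dots> \<le> (\<Sum>v\<in>V. H * u)"
  proof (rule sum_mono)
    fix v assume v: "v \<in> V"
    have "(\<Sum>a\<in>A. if v \<in> N q a then H * (real (q a) / p) else 0) =
       H * sum (\<lambda>a. real (q a) / p)
         {a \<in> A. sum (\<lambda>a. real (q a) / p) (weakly_preferred (pref v) A a) < u}"
      unfolding sum_distrib_left sum.inter_filter[OF fin(1)]
      by (intro sum.cong) (auto simp: N_def v)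
    also have "\<dots> \<le> H * u"
      using pos fin lin[OF v] by (intro mult_left_mono mass_below_threshold) auto
    finally show "(\<Sum>a\<in>A. if v \<in> N q a then H * (real (q a) / p) else 0) \<le> H * u" .
  qed
  finally have le: "(\<Sum>a\<in>A. real (q a) / p) \<le> H * u * card V" by (simp add: mult_ac)
  show ?thesis
  \<comment> \<open>The solution is the top corner, where candidates below price 1 have load at most
    1. Its mass exceeds that of \<open>q\<close> by \<open>card A / p\<close>, which is at most
    \<open>\<epsilon>\<close>.\<close>
  proof (rule that[of "\<lambda>a. real (Suc (q a)) / p"])
    fix a assume a: "a \<in> A"
    show "0 \<le> real (Suc (q a)) / p \<and> real (Suc (q a)) / p \<le> 1"
      using q(1)[OF a] by (auto simp: field_simps)
    assume lt: "real (Suc (q a)) / p < 1"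
    then show "H * card {v \<in> V. (\<Sum>c\<in>weakly_preferred (pref v) A a. real (Suc (q c)) / p) < u} \<le> 1"
      using q(3)[OF a] p(1) by (auto simp: L_def N_def)
  next
    have "(\<Sum>a\<in>A. real (Suc (q a)) / p) = (\<Sum>a\<in>A. real (q a) / p) + card A / p"
      by (simp add: add_divide_distrib sum.distrib)
    moreover have "card A / p \<le> \<epsilon>" using p pos by (simp add: field_simps)
    ultimately show "(\<Sum>a\<in>A. real (Suc (q a)) / p) \<le> H * u * card V + \<epsilon>" using le by linarith
  qed
qed

lemma fractional_core:
  fixes A :: "'a set" and V :: "'v set" and u B :: real
  assumes fin: "finite A" "finite V"
    and lin: "\<And>v. v \<in> V \<Longrightarrow> strict_linear_order_on A (pref v)"
    and pos: "0 < u" "0 < B"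
  obtains x :: "'a \<Rightarrow> real" where "\<And>a. a \<in> A \<Longrightarrow> 0 \<le> x a \<and> x a \<le> 1"
    and "sum x A \<le> B"
    and "\<And>a. a \<in> A \<Longrightarrow> x a < 1 \<Longrightarrow>
           card {v \<in> V. sum x (weakly_preferred (pref v) A a) < u} \<le> u * card V / B"
proof (cases "V = {}")
  case True
  then show ?thesis using pos by (intro that[of "\<lambda>_. 0"]) auto
next
  case False
  define n where "n = real (card V)"
  have n: "n > 0" using False fin by (simp add: n_def card_gt_0_iff)
  \<comment> \<open>The number of voters is an integer, so a slightly smaller budget \<open>B'\<close> gives the same bound.\<close>
  define M where "M = real (Suc (nat \<lfloor>u * n / B\<rfloor>))"
  have uB: "0 \<le> u * n / B" using pos n by simp
  have M: "u * n / B < M" "0 < M" unfolding M_def using uB by (auto; linarith)+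
  then have "u * n / M < B" using pos by (simp add: field_simps)
  then obtain B' where B': "u * n / M < B'" "B' < B" using dense by blast
  have "0 < u * n / M" using pos n M by simp
  then have B'pos: "0 < B'" using B'(1) by linarith
  \<comment> \<open>\<open>H\<close> makes \<open>H * u * card V\<close> equal to \<open>B'\<close>,
    and the grid error receives the remaining \<open>B - B'\<close>.\<close>
  obtain x where x: "\<And>a. a \<in> A \<Longrightarrow> 0 \<le> x a \<and> x a \<le> 1"
     "sum x A \<le> (B' / (u * n)) * u * card V + (B - B')"
     "\<And>a. a \<in> A \<Longrightarrow> x a < 1 \<Longrightarrow>
           (B' / (u * n)) * card {v \<in> V. sum x (weakly_preferred (pref v) A a) < u} \<le> 1"
  proof (rule fractional_core_approx[OF fin, where pref = pref and u = u and
        H = "B' / (u * n)" and \<epsilon> = "B - B'"])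
    show "0 < B' / (u * n)" using pos n B'pos by simp
  qed (use lin pos B' in auto)
  show ?thesis
  proof (rule that[of x])
    show "0 \<le> x a \<and> x a \<le> 1" if "a \<in> A" for a using x(1) that .
    show "sum x A \<le> B" using x(2) pos n by (simp add: n_def[symmetric])
    fix a assume a: "a \<in> A" "x a < 1"
    let ?c = "card {v \<in> V. sum x (weakly_preferred (pref v) A a) < u}"
    have "real ?c \<le> u * n / B'" using x(3)[OF a] pos n B'pos by (simp add: field_simps)
    also have "\<dots> < M" using B' B'pos M by (simp add: field_simps)
    finally have "?c \<le> nat \<lfloor>u * n / B\<rfloor>" unfolding M_def by linarith
    then show "real ?c \<le> u * card V / B" using uB unfolding n_def by linarith
  qed
qed

section \<open>Pipage rounding\<close>

text \<open>If both \<open>c\<close> and \<open>d\<close> lie in \<open>T\<close>, the product is a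
  quadratic in \<open>s\<close> with leading coefficient \<open>- K * \<mu>^2 \<le> 0\<close>;
  otherwise it is affine. Hence it lies below its tangent at \<open>s = 0\<close>, whose slope is
  \<open>Q\<close>.\<close>

lemma prod_transfer_upper_tangent:
  fixes x :: "'a \<Rightarrow> real" and \<mu> :: real
  assumes "finite T" "c \<noteq> d" "0 \<le> \<mu>" "\<mu> \<le> 1" "\<And>a. a \<in> T \<Longrightarrow> 0 \<le> x a \<and> x a \<le> 1"
  obtains Q where "\<And>s. (\<Prod>a\<in>T. 1 - \<mu> * (x(c := x c + s, d := x d - s)) a)
                      \<le> (\<Prod>a\<in>T. 1 - \<mu> * x a) + Q * s"
proof -
  define R where "R = T - {c, d}"
  define K where "K = (\<Prod>a\<in>R. 1 - \<mu> * x a)"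
  have fR: "finite R" "c \<notin> R" "d \<notin> R" using assms by (auto simp: R_def)
  have K: "K \<ge> 0" unfolding K_def using assms
    by (intro prod_nonneg) (auto simp: R_def mult_le_one)
  have upd: "(\<Prod>a\<in>R. 1 - \<mu> * (x(c := y, d := z)) a) = K" for y z
    unfolding K_def by (rule prod.cong) (use fR in auto)
  consider "c \<in> T" "d \<in> T" | "c \<in> T" "d \<notin> T" | "c \<notin> T" "d \<in> T" | "c \<notin> T" "d \<notin> T" by blast
  then show ?thesis
  proof cases
    case 1
    then have T: "T = insert c (insert d R)" by (auto simp: R_def)
    show ?thesis
    proof (rule that[of "K * (\<mu> * (1 - \<mu> * x c) - \<mu> * (1 - \<mu> * x d))"])
      fix s
      have "(\<Prod>a\<in>T. 1 - \<mu> * (x(c := x c + s, d := x d - s)) a) =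
         (1 - \<mu> * (x c + s)) * ((1 - \<mu> * (x d - s)) * K)"
        unfolding T using fR assms(2) upd[of "x c + s" "x d - s"] by (simp del: fun_upd_apply) simp
      moreover have "(\<Prod>a\<in>T. 1 - \<mu> * x a) = (1 - \<mu> * x c) * ((1 - \<mu> * x d) * K)"
        unfolding T using fR assms(2) by (simp add: K_def)
      moreover have "(1 - \<mu> * (x c + s)) * ((1 - \<mu> * (x d - s)) * K) =
         (1 - \<mu> * x c) * ((1 - \<mu> * x d) * K)
          + K * (\<mu> * (1 - \<mu> * x c) - \<mu> * (1 - \<mu> * x d)) * s - K * (\<mu> * s)^2"
        by (simp add: algebra_simps power2_eq_square)
      moreover have "0 \<le> K * (\<mu> * s)^2" using K by simp
      ultimately show "(\<Prod>a\<in>T. 1 - \<mu> * (x(c := x c + s, d := x d - s)) a)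
         \<le> (\<Prod>a\<in>T. 1 - \<mu> * x a) + K * (\<mu> * (1 - \<mu> * x c) - \<mu> * (1 - \<mu> * x d)) * s"
        by linarith
    qed
  next
    case 2
    then have T: "T = insert c R" by (auto simp: R_def)
    show ?thesis
    proof (rule that[of "- K * \<mu>"])
      fix s
      have "(\<Prod>a\<in>T. 1 - \<mu> * (x(c := x c + s, d := x d - s)) a) = (1 - \<mu> * (x c + s)) * K"
        unfolding T using fR assms(2) upd[of "x c + s" "x d - s"] by (simp del: fun_upd_apply) simp
      moreover have "(\<Prod>a\<in>T. 1 - \<mu> * x a) = (1 - \<mu> * x c) * K"
        unfolding T using fR by (simp add: K_def)
      ultimately show "(\<Prod>a\<in>T. 1 - \<mu> * (x(c := x c + s, d := x d - s)) a)
         \<le> (\<Prod>a\<in>T. 1 - \<mu> * x a) + (- K * \<mu>) * s" by (simp add: algebra_simps)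
    qed
  next
    case 3
    then have T: "T = insert d R" by (auto simp: R_def)
    show ?thesis
    proof (rule that[of "K * \<mu>"])
      fix s
      have "(\<Prod>a\<in>T. 1 - \<mu> * (x(c := x c + s, d := x d - s)) a) = (1 - \<mu> * (x d - s)) * K"
        unfolding T using fR assms(2) upd[of "x c + s" "x d - s"] by (simp del: fun_upd_apply) simp
      moreover have "(\<Prod>a\<in>T. 1 - \<mu> * x a) = (1 - \<mu> * x d) * K"
        unfolding T using fR by (simp add: K_def)
      ultimately show "(\<Prod>a\<in>T. 1 - \<mu> * (x(c := x c + s, d := x d - s)) a)
         \<le> (\<Prod>a\<in>T. 1 - \<mu> * x a) + (K * \<mu>) * s" by (simp add: algebra_simps)
    qed
  next
    case 4
    then have T: "T = R" by (auto simp: R_def)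
    show ?thesis
      by (rule that[of 0]) (use upd in \<open>simp add: T K_def del: fun_upd_apply\<close>)
  qed
qed

text \<open>The right-hand sum is a multilinear potential whose value at a 0/1 vector is the
  left-hand sum. Two fractional coordinates can be traded against each other without raising it
  until one becomes integral; the induction is on the number of fractional coordinates, and a last
  one is rounded up.\<close>

lemma pipage_rounding:
  fixes x :: "'a \<Rightarrow> real" and l :: real and T :: "'v \<Rightarrow> 'a set"
  assumes fin: "finite A" "finite V" and lam: "0 \<le> l" "l \<le> 1"
    and T: "\<And>v. v \<in> V \<Longrightarrow> T v \<subseteq> A"
    and x: "\<And>a. a \<in> A \<Longrightarrow> 0 \<le> x a \<and> x a \<le> 1"
  shows "\<exists>C\<subseteq>A. {a \<in> A. x a = 1} \<subseteq> C \<and> real (card C) < sum x A + 1 \<and>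
           (\<Sum>v\<in>V. l ^ card (C \<inter> T v)) \<le> (\<Sum>v\<in>V. \<Prod>a\<in>T v. 1 - (1 - l) * x a)"
  using x
proof (induction "card {a \<in> A. 0 < x a \<and> x a < 1}" arbitrary: x rule: less_induct)
  case less
  let ?F = "{a \<in> A. 0 < x a \<and> x a < 1}"
  let ?\<Phi> = "\<lambda>x. \<Sum>v\<in>V. \<Prod>a\<in>T v. 1 - (1 - l) * x a"
  have finF: "finite ?F" using fin by simp
  have finT: "finite (T v)" if "v \<in> V" for v using T[OF that] fin finite_subset by blast
  consider "\<exists>c d. c \<in> ?F \<and> d \<in> ?F \<and> c \<noteq> d" | "\<exists>c. ?F \<subseteq> {c}" by blast
  then show ?case
  proof cases
    case 1
    then obtain c d where cd: "c \<in> ?F" "d \<in> ?F" "c \<noteq> d" by blast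
    define y where "y s = x(c := x c + s, d := x d - s)" for s
    have "\<exists>Q. \<forall>s. (\<Prod>a\<in>T v. 1 - (1 - l) * y s a) \<le> (\<Prod>a\<in>T v. 1 - (1 - l) * x a) + Q * s"
      if v: "v \<in> V" for v
    proof -
      have "\<And>a. a \<in> T v \<Longrightarrow> 0 \<le> x a \<and> x a \<le> 1" using less.prems T[OF v] by blast
      then obtain Q where "\<And>s. (\<Prod>a\<in>T v. 1 - (1 - l) * (x(c := x c + s, d := x d - s)) a)
                      \<le> (\<Prod>a\<in>T v. 1 - (1 - l) * x a) + Q * s"
        using prod_transfer_upper_tangent[OF finT[OF v] cd(3), of "1 - l" x] lam by auto
      then show ?thesis unfolding y_def by blast
    qed
    then obtain Q where Q: "\<And>v s. v \<in> V \<Longrightarrow>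
        (\<Prod>a\<in>T v. 1 - (1 - l) * y s a) \<le> (\<Prod>a\<in>T v. 1 - (1 - l) * x a) + Q v * s"
      by metis
    have \<Phi>: "?\<Phi> (y s) \<le> ?\<Phi> x + sum Q V * s" for s
      unfolding sum_distrib_right sum.distrib[symmetric] by (rule sum_mono) (rule Q)
    have sumy: "sum (y s) A = sum x A" for s
    proof -
      have A: "A = insert c (insert d (A - {c, d}))" using cd by auto
      have "sum (y s) (A - {c, d}) = sum x (A - {c, d})"
        by (rule sum.cong) (auto simp: y_def)
      then show ?thesis
        by (subst (1 2) A) (use fin cd in \<open>simp add: y_def\<close>)
    qed
    \<comment> \<open>Only fractional coordinates move, so coordinates equal to 1 survive the
      recursion.\<close>
    have ones: "{a \<in> A. x a = 1} \<subseteq> {a \<in> A. y s a = 1}" for s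
      using cd by (auto simp: y_def)
    have step: ?thesis if s: "?\<Phi> (y s) \<le> ?\<Phi> x" "0 \<le> y s c" "y s c \<le> 1" "0 \<le> y s d" "y s d \<le> 1"
        and int: "y s c \<in> {0, 1} \<or> y s d \<in> {0, 1}" for s
    proof -
      have y01: "0 \<le> y s a \<and> y s a \<le> 1" if "a \<in> A" for a
        using s less.prems[OF that] by (cases "a = c"; cases "a = d") (auto simp: y_def)
      have "{a \<in> A. 0 < y s a \<and> y s a < 1} \<subset> ?F"
      proof -
        have "{a \<in> A. 0 < y s a \<and> y s a < 1} \<subseteq> ?F"
        proof
          fix a assume "a \<in> {a \<in> A. 0 < y s a \<and> y s a < 1}"
          then show "a \<in> ?F" using cd by (cases "a = c"; cases "a = d") (auto simp: y_def)
        qed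
        moreover have "c \<notin> {a \<in> A. 0 < y s a \<and> y s a < 1} \<or> d \<notin> {a \<in> A. 0 < y s a \<and> y s a < 1}"
          using int by auto
        ultimately show ?thesis using cd by blast
      qed
      then have "card {a \<in> A. 0 < y s a \<and> y s a < 1} < card ?F"
        by (rule psubset_card_mono[OF finF])
      from less.hyps[OF this y01] obtain C where C: "C \<subseteq> A" "{a \<in> A. y s a = 1} \<subseteq> C"
        "real (card C) < sum (y s) A + 1" "(\<Sum>v\<in>V. l ^ card (C \<inter> T v)) \<le> ?\<Phi> (y s)"
        by blast
      show ?thesis
        using C ones[of s] s(1) sumy[of s] by (intro exI[of _ C]) auto
    qed
    show ?thesis
    \<comment> \<open>The sign of the total slope selects the direction; the shift is the longest
      that keeps both coordinates in the unit interval.\<close>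
    proof (cases "sum Q V \<le> 0")
      case True
      have "sum Q V * min (1 - x c) (x d) \<le> 0"
        using True cd by (intro mult_nonpos_nonneg) auto
      then have "?\<Phi> (y (min (1 - x c) (x d))) \<le> ?\<Phi> x"
        using \<Phi>[of "min (1 - x c) (x d)"] by linarith
      then show ?thesis
        by (rule step) (use cd in \<open>auto simp: y_def min_def\<close>)
    next
      case False
      have "sum Q V * (- min (x c) (1 - x d)) \<le> 0"
        using False cd by (intro mult_nonneg_nonpos) auto
      then have "?\<Phi> (y (- min (x c) (1 - x d))) \<le> ?\<Phi> x"
        using \<Phi>[of "- min (x c) (1 - x d)"] by linarith
      then show ?thesis
        by (rule step) (use cd in \<open>auto simp: y_def min_def\<close>)
    qed
  next
    case 2
    \<comment> \<open>With at most one fractional coordinate left, rounding up adds less than 1 to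
      the mass.\<close>
    define C where "C = {a \<in> A. 0 < x a}"
    have CA: "C \<subseteq> A" "finite C" using fin by (auto simp: C_def)
    have "real (card C) - sum x A = (\<Sum>a\<in>C. 1 - x a)"
    proof -
      have "sum x A = sum x C"
        by (rule sum.mono_neutral_right)
          (use fin less.prems in \<open>auto simp: C_def less_le\<close>)
      then show ?thesis by (simp add: sum_subtractf)
    qed
    also have "\<dots> = (\<Sum>a\<in>?F. 1 - x a)"
      by (rule sum.mono_neutral_right)
         (use CA less.prems in \<open>auto simp: C_def less_le\<close>)
    also have "\<dots> < 1"
    proof (cases "?F = {}")
      case True
      then show ?thesis by (simp only: sum.empty)
    next
      case False
      then obtain c where c: "?F = {c}" using 2 by blast
      then have "0 < x c" by blast
      then show ?thesis unfolding c by simp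
    qed
    finally have card: "real (card C) < sum x A + 1" by linarith
    have "(\<Sum>v\<in>V. l ^ card (C \<inter> T v)) \<le> ?\<Phi> x"
    proof (rule sum_mono)
      fix v assume v: "v \<in> V"
      \<comment> \<open>Factor by factor: \<open>l\<close> is the value at \<open>x a = 1\<close>,
        the least possible, and off \<open>C\<close> one has \<open>x a = 0\<close>.\<close>
      have "l ^ card (C \<inter> T v) = (\<Prod>a\<in>T v. if a \<in> C then l else 1)"
        using finT[OF v] by (simp add: prod.If_cases Int_commute)
      also have "\<dots> \<le> (\<Prod>a\<in>T v. 1 - (1 - l) * x a)"
      proof (rule prod_mono)
        fix a assume "a \<in> T v"
        then have a: "a \<in> A" using T[OF v] by auto
        have "(1 - l) * x a \<le> (1 - l) * 1"
          using lam less.prems[OF a] by (intro mult_left_mono) auto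
        moreover have "x a = 0" if "a \<notin> C" using that a less.prems[OF a] by (auto simp: C_def)
        ultimately show "0 \<le> (if a \<in> C then l else 1) \<and>
          (if a \<in> C then l else 1) \<le> 1 - (1 - l) * x a" using lam by auto
      qed
      finally show "l ^ card (C \<inter> T v) \<le> (\<Prod>a\<in>T v. 1 - (1 - l) * x a)" .
    qed
    then show ?thesis using CA card by (intro exI[of _ C]) (auto simp: C_def)
  qed
qed

section \<open>Rounds of committees\<close>

text \<open>The Chernoff bound for at most \<open>t - 1\<close> successes at mean \<open>u\<close>; unlike \<^const>\<open>omega\<close> it is
  also needed for means between \<open>t - 1\<close> and \<open>t\<close>.\<close>

definition chernoff :: "real \<Rightarrow> nat \<Rightarrow> real" where
  "chernoff u t = exp (- (u - (real t - 1))) * (u / (real t - 1)) ^ (t - 1)"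

text \<open>The outer exponent \<open>\<gamma> * t\<close> cancels both inner denominators, and
  \<open>t - 1\<close> becomes a natural exponent.\<close>

lemma omega_eq_chernoff:
  assumes "1 \<le> \<gamma>" "2 \<le> t"
  shows "omega \<gamma> t = chernoff (\<gamma> * real t) t"
proof -
  define u where "u = \<gamma> * real t"
  define r where "r = real t - 1"
  have r: "0 < r" "real (t - 1) = r" using assms by (auto simp: r_def of_nat_diff)
  have u: "0 < u" using assms by (simp add: u_def)
  have "omega \<gamma> t = (exp (- ((u - r) / u)) / (r / u) powr (r / u)) powr u"
    by (simp add: omega_def u_def r_def algebra_simps)
  also have "\<dots> = exp (- ((u - r) / u)) powr u / ((r / u) powr (r / u)) powr u"
    by (rule powr_divide)
  also have "exp (- ((u - r) / u)) powr u = exp (- (u - r))"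
    using u by (simp add: powr_def)
  also have "((r / u) powr (r / u)) powr u = (r / u) ^ (t - 1)"
    using u r by (simp add: powr_powr powr_realpow[symmetric])
  finally show ?thesis
    by (simp add: chernoff_def u_def r_def power_divide)
qed

lemma chernoff_pos: "2 \<le> t \<Longrightarrow> 0 < u \<Longrightarrow> 0 < chernoff u t"
  by (simp add: chernoff_def)

lemma t_beats_mono:
  assumes "t_beats pref t v C a" "C \<subseteq> D" "finite D"
  shows "t_beats pref t v D a"
proof -
  have "card {c \<in> C. (c, a) \<in> pref v} \<le> card {c \<in> D. (c, a) \<in> pref v}"
    using assms by (intro card_mono) auto
  then show ?thesis using assms by (simp add: t_beats_def)
qed

text \<open>The rounded committee is tested, for each voter, on one set only: the shortest segment
  \<open>T v\<close> of mass at least \<open>u\<close>. If it holds \<open>t\<close> members of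
  \<open>C\<close>, every candidate outside \<open>C\<close> with segment mass at least
  \<open>u\<close> is beaten, since its segment contains \<open>T v\<close>; the other candidates
  fall under \<open>fractional_core\<close>. \<open>U\<close> collects the voters failing the
  test.\<close>

lemma one_round:
  fixes A :: "'a set" and V :: "'v set" and u B :: real
  assumes fin: "finite A" "finite V"
    and lin: "\<And>v. v \<in> V \<Longrightarrow> strict_linear_order_on A (pref v)"
    and t: "2 \<le> t" and u: "real t - 1 \<le> u" and B: "0 < B"
  obtains C U where "C \<subseteq> A" "real (card C) < B + 1" "U \<subseteq> V"
    "card U \<le> chernoff u t * card V"
    "\<And>a. a \<in> A - C \<Longrightarrow> card {v \<in> V - U. \<not> t_beats pref t v C a} \<le> u * card V / B"
proof -
  have upos: "0 < u" using t u by simp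
  define r where "r = real t - 1"
  have r: "0 < r" "r \<le> u" using t u by (auto simp: r_def)
  obtain x where x: "\<And>a. a \<in> A \<Longrightarrow> 0 \<le> x a \<and> x a \<le> 1" "sum x A \<le> B"
    and core: "\<And>a. a \<in> A \<Longrightarrow> x a < 1 \<Longrightarrow>
           card {v \<in> V. sum x (weakly_preferred (pref v) A a) < u} \<le> u * card V / B"
    by (rule fractional_core[OF fin, where pref = pref and u = u and B = B])
      (use lin upos B in auto)
  define S where "S v = {a \<in> A. u \<le> sum x (weakly_preferred (pref v) A a)}" for v
  \<comment> \<open>For a voter outside \<open>V'\<close> all segments have mass below
    \<open>u\<close>, so the core inequality alone accounts for such a voter.\<close>
  define V' where "V' = {v \<in> V. S v \<noteq> {}}"
  have V': "V' \<subseteq> V" "finite V'" using fin by (auto simp: V'_def)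
  have "\<exists>b. b \<in> S v \<and> (\<forall>a\<in>S v. weakly_preferred (pref v) A b \<subseteq> weakly_preferred (pref v) A a)"
    if v: "v \<in> V'" for v
  proof -
    have "S v \<subseteq> A" "S v \<noteq> {}" "strict_linear_order_on A (pref v)"
      using v lin by (auto simp: S_def V'_def)
    then obtain b where "b \<in> S v"
      "\<And>a. a \<in> S v \<Longrightarrow> weakly_preferred (pref v) A b \<subseteq> weakly_preferred (pref v) A a"
      using smallest_weakly_preferred[OF fin(1) _ \<open>S v \<subseteq> A\<close> \<open>S v \<noteq> {}\<close>] by blast
    then show ?thesis by blast
  qed
  then have "\<exists>b. \<forall>v\<in>V'. b v \<in> S v \<and>
      (\<forall>a\<in>S v. weakly_preferred (pref v) A (b v) \<subseteq> weakly_preferred (pref v) A a)"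
    by (intro bchoice) blast
  then obtain b where b: "\<And>v. v \<in> V' \<Longrightarrow> b v \<in> S v"
    "\<And>v a. v \<in> V' \<Longrightarrow> a \<in> S v \<Longrightarrow>
       weakly_preferred (pref v) A (b v) \<subseteq> weakly_preferred (pref v) A a"
    by blast
  define T where "T v = weakly_preferred (pref v) A (b v)" for v
  have TA: "T v \<subseteq> A" for v by (auto simp: T_def weakly_preferred_def)
  \<comment> \<open>The value \<open>(t - 1) / u\<close> minimises the Chernoff expression
    \<open>exp (- ((1 - l) * u)) / l ^ (t - 1)\<close>.\<close>
  define l where "l = r / u"
  have l: "0 < l" "l \<le> 1" using r upos by (auto simp: l_def)
  obtain C where C: "C \<subseteq> A" "{a \<in> A. x a = 1} \<subseteq> C" "real (card C) < sum x A + 1"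
    "(\<Sum>v\<in>V'. l ^ card (C \<inter> T v)) \<le> (\<Sum>v\<in>V'. \<Prod>a\<in>T v. 1 - (1 - l) * x a)"
  proof -
    have "\<exists>C\<subseteq>A. {a \<in> A. x a = 1} \<subseteq> C \<and> real (card C) < sum x A + 1 \<and>
        (\<Sum>v\<in>V'. l ^ card (C \<inter> T v)) \<le> (\<Sum>v\<in>V'. \<Prod>a\<in>T v. 1 - (1 - l) * x a)"
      by (rule pipage_rounding[OF fin(1) V'(2)]) (use l TA x in auto)
    then show ?thesis using that by blast
  qed
  have finC: "finite C" using C fin finite_subset by blast
  define U where "U = {v \<in> V'. card (C \<inter> T v) < t}"
  have U: "U \<subseteq> V'" by (auto simp: U_def)
  \<comment> \<open>Markov's inequality: at most \<open>t - 1\<close> hits and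
    \<open>l \<le> 1\<close> give each voter in \<open>U\<close> a term of at least
    \<open>l ^ (t - 1)\<close>.\<close>
  have "card U * l ^ (t - 1) = (\<Sum>v\<in>U. l ^ (t - 1))" by simp
  also have "\<dots> \<le> (\<Sum>v\<in>U. l ^ card (C \<inter> T v))"
    by (rule sum_mono) (use l in \<open>auto simp: U_def intro!: power_decreasing\<close>)
  also have "\<dots> \<le> (\<Sum>v\<in>V'. l ^ card (C \<inter> T v))"
    using V' U l by (intro sum_mono2) auto
  also note C(4)
  also have "(\<Sum>v\<in>V'. \<Prod>a\<in>T v. 1 - (1 - l) * x a) \<le> (\<Sum>v\<in>V'. exp (- (u - r)))"
  proof (rule sum_mono)
    fix v assume v: "v \<in> V'"
    have finT: "finite (T v)" using TA fin finite_subset by blast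
    have "(\<Prod>a\<in>T v. 1 - (1 - l) * x a) \<le> (\<Prod>a\<in>T v. exp (- ((1 - l) * x a)))"
    proof (rule prod_mono)
      fix a assume "a \<in> T v"
      then have "0 \<le> x a" "x a \<le> 1" using x TA by auto
      then have "(1 - l) * x a \<le> 1 * 1" using l by (intro mult_mono) auto
      then show "0 \<le> 1 - (1 - l) * x a \<and> 1 - (1 - l) * x a \<le> exp (- ((1 - l) * x a))"
        using exp_ge_add_one_self[of "- ((1 - l) * x a)"] by auto
    qed
    also have "\<dots> = exp (- ((1 - l) * sum x (T v)))"
      using finT by (simp add: exp_sum[symmetric] sum_distrib_left sum_negf)
    also have "\<dots> \<le> exp (- ((1 - l) * u))"
      using b(1)[OF v] l by (auto simp: S_def T_def intro!: mult_left_mono)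
    also have "(1 - l) * u = u - r" using upos by (simp add: l_def field_simps)
    finally show "(\<Prod>a\<in>T v. 1 - (1 - l) * x a) \<le> exp (- (u - r))" .
  qed
  also have "\<dots> = card V' * exp (- (u - r))" by simp
  also have "\<dots> \<le> card V * exp (- (u - r))"
    using V' fin by (intro mult_right_mono) (auto intro: card_mono)
  finally have "card U * l ^ (t - 1) \<le> card V * exp (- (u - r))" .
  then have cardU: "card U \<le> chernoff u t * card V"
    using r upos
    by (simp add: chernoff_def l_def r_def[symmetric] power_divide field_simps)
  show ?thesis
  proof (rule that[of C U])
    show "C \<subseteq> A" by fact
    show "real (card C) < B + 1" using C(3) x(2) by linarith
    show "U \<subseteq> V" using U V' by blast
    show "card U \<le> chernoff u t * card V" by fact
    fix a assume a: "a \<in> A - C"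
    then have xa: "x a < 1" using x(1)[of a] C(2) by (auto simp: less_le)
    have "t_beats pref t v C a" if v: "v \<in> V - U" "u \<le> sum x (weakly_preferred (pref v) A a)" for v
    proof -
      have aS: "a \<in> S v" using v a by (auto simp: S_def)
      then have v': "v \<in> V'" using v by (auto simp: V'_def)
      then have "t \<le> card (C \<inter> T v)" using v by (auto simp: U_def)
      moreover have "C \<inter> T v \<subseteq> {c \<in> C. (c, a) \<in> pref v}"
        using b(2)[OF v' aS] a by (auto simp: T_def weakly_preferred_def)
      then have "card (C \<inter> T v) \<le> card {c \<in> C. (c, a) \<in> pref v}"
        using finC by (intro card_mono) auto
      ultimately show ?thesis by (simp add: t_beats_def)
    qed
    then have "{v \<in> V - U. \<not> t_beats pref t v C a}
        \<subseteq> {v \<in> V. sum x (weakly_preferred (pref v) A a) < u}"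
      by (auto simp: not_le[symmetric])
    then have "card {v \<in> V - U. \<not> t_beats pref t v C a}
        \<le> card {v \<in> V. sum x (weakly_preferred (pref v) A a) < u}"
      using fin by (intro card_mono) auto
    then show "card {v \<in> V - U. \<not> t_beats pref t v C a} \<le> u * card V / B"
      using core[of a] a xa by (meson DiffD1 of_nat_mono order_trans)
  qed
qed

text \<open>A further round is played on the failed voters \<open>U\<close> alone and its committee
  is added. Voters outside \<open>U\<close> lose nothing, since beating is monotone in the
  committee; so failure rates multiply and domination counts add.\<close>

lemma round_after:
  fixes A :: "'a set" and V :: "'v set" and u B D W :: real
  assumes fin: "finite A" "finite V"
    and lin: "\<And>v. v \<in> V \<Longrightarrow> strict_linear_order_on A (pref v)"
    and t: "2 \<le> t" and u: "real t - 1 \<le> u" and B: "0 < B"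
    and C: "C \<subseteq> A" and U: "U \<subseteq> V" "card U \<le> W * card V"
    and dom: "\<And>a. a \<in> A - C \<Longrightarrow> card {v \<in> V - U. \<not> t_beats pref t v C a} \<le> D * card V"
  obtains C' U' where "C' \<subseteq> A" "real (card C') < card C + B + 1" "U' \<subseteq> V"
    "card U' \<le> chernoff u t * W * card V"
    "\<And>a. a \<in> A - C' \<Longrightarrow>
       card {v \<in> V - U'. \<not> t_beats pref t v C' a} \<le> (D + u / B * W) * card V"
proof -
  have finU: "finite U" using U fin finite_subset by blast
  have upos: "0 < u" using t u by simp
  obtain C1 U' where C1: "C1 \<subseteq> A" "real (card C1) < B + 1" "U' \<subseteq> U"
    "card U' \<le> chernoff u t * card U"
    and dom1: "\<And>a. a \<in> A - C1 \<Longrightarrow> card {v \<in> U - U'. \<not> t_beats pref t v C1 a} \<le> u * card U / B"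
    by (rule one_round[OF fin(1) finU, where pref = pref and t = t and u = u and B = B])
      (use lin U t u B in auto)
  have finC: "finite (C \<union> C1)" using C C1 fin finite_subset by blast
  show ?thesis
  proof (rule that[of "C \<union> C1" U'])
    show "C \<union> C1 \<subseteq> A" using C C1 by blast
    have "real (card (C \<union> C1)) \<le> card C + card C1" using card_Un_le[of C C1] by linarith
    then show "real (card (C \<union> C1)) < card C + B + 1" using C1(2) by linarith
    show "U' \<subseteq> V" using C1 U by blast
    have "chernoff u t * card U \<le> chernoff u t * (W * card V)"
      using U chernoff_pos[OF t upos] by (intro mult_left_mono) auto
    then show "card U' \<le> chernoff u t * W * card V" using C1(4) by (simp add: mult.assoc)
    fix a assume a: "a \<in> A - (C \<union> C1)"
    have "{v \<in> V - U'. \<not> t_beats pref t v (C \<union> C1) a} \<subseteq>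
       {v \<in> V - U. \<not> t_beats pref t v C a} \<union> {v \<in> U - U'. \<not> t_beats pref t v C1 a}"
      using t_beats_mono[OF _ _ finC, of pref t _ _ a] by blast
    then have "card {v \<in> V - U'. \<not> t_beats pref t v (C \<union> C1) a} \<le>
       card ({v \<in> V - U. \<not> t_beats pref t v C a} \<union> {v \<in> U - U'. \<not> t_beats pref t v C1 a})"
      using fin finU by (intro card_mono) auto
    also have "\<dots> \<le> card {v \<in> V - U. \<not> t_beats pref t v C a} +
        card {v \<in> U - U'. \<not> t_beats pref t v C1 a}"
      by (rule card_Un_le)
    finally have "real (card {v \<in> V - U'. \<not> t_beats pref t v (C \<union> C1) a}) \<le>
       D * card V + u * card U / B"
      using dom[of a] dom1[of a] a by auto
    also have "u * card U / B \<le> u * (W * card V) / B"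
      using U upos B by (intro divide_right_mono mult_left_mono) auto
    finally show "card {v \<in> V - U'. \<not> t_beats pref t v (C \<union> C1) a} \<le> (D + u / B * W) * card V"
      by (simp add: algebra_simps)
  qed
qed

lemma iterated_rounds:
  fixes A :: "'a set" and V :: "'v set" and u :: real and B :: "nat \<Rightarrow> real"
  assumes fin: "finite A" "finite V"
    and lin: "\<And>v. v \<in> V \<Longrightarrow> strict_linear_order_on A (pref v)"
    and t: "2 \<le> t" and u: "real t - 1 \<le> u" and B: "\<And>i. 0 < B i"
  shows "\<exists>C U. C \<subseteq> A \<and> real (card C) \<le> (\<Sum>i<m. B i + 1) \<and> U \<subseteq> V \<and>
    card U \<le> chernoff u t ^ m * card V \<and>
    (\<forall>a\<in>A - C. card {v \<in> V - U. \<not> t_beats pref t v C a} \<le>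
       (\<Sum>i<m. u / B i * chernoff u t ^ i) * card V)"
proof (induction m)
  case 0
  \<comment> \<open>Before the first round every voter counts as failed.\<close>
  show ?case by (rule exI[of _ "{}"], rule exI[of _ V]) auto
next
  case (Suc m)
  then obtain C U where C: "C \<subseteq> A" "real (card C) \<le> (\<Sum>i<m. B i + 1)" "U \<subseteq> V"
    "card U \<le> chernoff u t ^ m * card V"
    and dom: "\<And>a. a \<in> A - C \<Longrightarrow> card {v \<in> V - U. \<not> t_beats pref t v C a} \<le>
       (\<Sum>i<m. u / B i * chernoff u t ^ i) * card V"
    by blast
  obtain C' U' where "C' \<subseteq> A" "real (card C') < card C + B m + 1" "U' \<subseteq> V"
    "card U' \<le> chernoff u t * chernoff u t ^ m * card V"
    "\<And>a. a \<in> A - C' \<Longrightarrow> card {v \<in> V - U'. \<not> t_beats pref t v C' a} \<le>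
       ((\<Sum>i<m. u / B i * chernoff u t ^ i) + u / B m * chernoff u t ^ m) * card V"
    by (rule round_after[OF fin lin t u B[of m] C(1,3,4) dom]) auto
  then show ?case using C(2)
    by (intro exI[of _ C'] exI[of _ U']) auto
qed

text \<open>Voters in \<open>U\<close> are given up for every candidate. A committee smaller than
  \<open>t\<close> is padded, which by monotonicity harms no voter; hence the requirement
  \<open>t \<le> K\<close>.\<close>

lemma undominated_from_partial:
  fixes D W K \<alpha> :: real
  assumes el: "election V A pref" and tA: "t \<le> card A"
    and C: "C \<subseteq> A" and U: "U \<subseteq> V" "card U \<le> W * card V"
    and dom: "\<And>a. a \<in> A - C \<Longrightarrow> card {v \<in> V - U. \<not> t_beats pref t v C a} \<le> D * card V"
    and al: "D + W \<le> \<alpha>" and K: "real t \<le> K" "real (card C) \<le> K"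
  shows "\<exists>C. undominated V A pref t \<alpha> C \<and> real (card C) \<le> K"
proof -
  have fin: "finite A" "finite V" using el by (auto simp: election_def)
  have finC: "finite C" using C fin finite_subset by blast
  obtain C' where C': "C \<subseteq> C'" "C' \<subseteq> A" "t \<le> card C'" "real (card C') \<le> K"
  proof (cases "t \<le> card C")
    case True
    then show ?thesis using that C K by blast
  next
    case False
    have "\<exists>C'. C \<subseteq> C' \<and> C' \<subseteq> A \<and> card C' = t"
      using exists_subset_between[of C t A] False tA C fin by auto
    then show ?thesis using that K by blast
  qed
  have finC': "finite C'" using C' fin finite_subset by blast
  have "real (card {v \<in> V. \<not> t_beats pref t v C' a}) \<le> of_int \<lfloor>\<alpha> * real (card V)\<rfloor>"
    if a: "a \<in> A - C'" for a
  proof -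
    have "{v \<in> V. \<not> t_beats pref t v C' a} \<subseteq> {v \<in> V - U. \<not> t_beats pref t v C a} \<union> U"
      using t_beats_mono[OF _ C'(1) finC', of pref t _ a] by blast
    then have "card {v \<in> V. \<not> t_beats pref t v C' a} \<le>
        card ({v \<in> V - U. \<not> t_beats pref t v C a} \<union> U)"
      using fin U finite_subset by (intro card_mono) auto
    also have "\<dots> \<le> card {v \<in> V - U. \<not> t_beats pref t v C a} + card U" by (rule card_Un_le)
    finally have "real (card {v \<in> V. \<not> t_beats pref t v C' a}) \<le> D * card V + W * card V"
      using dom[of a] a C'(1) U(2) by fastforce
    also have "\<dots> \<le> \<alpha> * card V"
      using mult_right_mono[OF al, of "real (card V)"] by (simp add: algebra_simps)
    finally have "int (card {v \<in> V. \<not> t_beats pref t v C' a}) \<le> \<lfloor>\<alpha> * real (card V)\<rfloor>"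
      by (simp add: le_floor_iff)
    then show ?thesis by linarith
  qed
  then show ?thesis using C' by (auto simp: undominated_def)
qed

section \<open>Committees from one and from many rounds\<close>

lemma undominated_one_round:
  assumes t: "2 \<le> t" and al: "\<alpha> \<le> 1" and el: "election V A pref" and tA: "t \<le> card A"
    and B: "0 < B" and g: "1 \<le> \<gamma>" and ineq: "\<gamma> * real t / real B + omega \<gamma> t \<le> \<alpha>"
  shows "\<exists>C. undominated V A pref t \<alpha> C \<and> card C \<le> B"
proof -
  define u where "u = \<gamma> * real t"
  have tu: "real t \<le> u" using g t by (simp add: u_def)
  have upos: "0 < u" using tu t by linarith
  have fin: "finite A" "finite V" and lin: "\<And>v. v \<in> V \<Longrightarrow> strict_linear_order_on A (pref v)"
    using el by (auto simp: election_def)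
  have w: "omega \<gamma> t = chernoff u t" using omega_eq_chernoff[OF g t] by (simp add: u_def)
  have tu1: "real t - 1 \<le> u" and B0: "0 < real B" using tu B by auto
  obtain C U where C: "C \<subseteq> A" "real (card C) < real B + 1" "U \<subseteq> V"
    "card U \<le> chernoff u t * card V"
    "\<And>a. a \<in> A - C \<Longrightarrow> card {v \<in> V - U. \<not> t_beats pref t v C a} \<le> u * card V / B"
    by (rule one_round[OF fin lin t tu1 B0]) auto
  \<comment> \<open>From \<open>\<alpha> \<le> 1\<close> and positivity of \<open>omega\<close>,
    \<open>B\<close> is at least \<open>u\<close>, which leaves room for padding to size
    \<open>t\<close>.\<close>
  have "u / B \<le> 1"
    using ineq al chernoff_pos[OF t upos] w unfolding u_def[symmetric] by linarith
  then have "real t \<le> real B" using tu B by (simp add: field_simps)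
  moreover have "u / B + chernoff u t \<le> \<alpha>" using ineq w by (simp add: u_def)
  \<comment> \<open>The rounding loss vanishes because \<open>B\<close> is an integer.\<close>
  moreover have "real (card C) \<le> real B" using C(2) by simp
  ultimately have "\<exists>C. undominated V A pref t \<alpha> C \<and> real (card C) \<le> real B"
    using undominated_from_partial[OF el tA C(1,3,4), of "u / real B" \<alpha> "real B"] C(5)
    by simp
  then show ?thesis by simp
qed

text \<open>Lowering the mean costs \<open>exp s\<close> in the exponential factor, while the power
  only shrinks.\<close>

lemma chernoff_shift:
  assumes "2 \<le> t" "0 \<le> s" "s < u"
  shows "chernoff (u - s) t \<le> exp s * chernoff u t"
proof -
  have "((u - s) / (real t - 1)) ^ (t - 1) \<le> (u / (real t - 1)) ^ (t - 1)"
    using assms by (intro power_mono divide_right_mono) auto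
  moreover have "exp (- (u - s - (real t - 1))) = exp s * exp (- (u - (real t - 1)))"
    by (simp add: exp_add[symmetric])
  ultimately show ?thesis by (simp add: chernoff_def)
qed

text \<open>Rounding up costs one candidate per round, which is one more than the logarithm in \<open>s\<^sub>1\<close>
  pays for. For \<open>\<tau> \<le> 3\<close> the unused tail of the geometric series covers it; otherwise lowering
  the mean of the last round by \<open>s\<close> does, at the price of a factor \<open>exp s\<close> in its failure rate.\<close>

lemma last_round_saving:
  fixes \<tau> D E k :: real
  assumes tau: "1 < \<tau>" and D: "1 \<le> D" and E: "\<tau> / D \<le> E" "1 \<le> E" and k: "2 \<le> k"
  obtains s where "0 \<le> s" "s \<le> 1" "exp s \<le> E" "1 \<le> log \<tau> D + s * D + k * D / (\<tau> - 1)"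
proof (cases "\<tau> \<le> 3")
  case True
  have "\<tau> - 1 \<le> k * D" using True mult_mono[OF k D] k by simp
  then have "1 \<le> k * D / (\<tau> - 1)" using tau by simp
  moreover have "0 \<le> log \<tau> D" using tau D by simp
  ultimately show ?thesis using E by (intro that[of 0]) auto
next
  case False
  have kD: "0 \<le> k * D / (\<tau> - 1)" using k D tau by simp
  have lD: "0 \<le> log \<tau> D" using tau D by simp
  show ?thesis
  proof (cases "exp 1 \<le> E")
    case True
    then show ?thesis using kD lD D by (intro that[of 1]) auto
  next
    case E1: False
    have lnE: "0 \<le> ln E" "ln E \<le> 1"
      using E E1 ln_le_cancel_iff[of E "exp 1"] by auto
    \<comment> \<open>With \<open>s = ln E\<close> the sum \<open>log \<tau> D + s\<close> already
      reaches 1, because \<open>\<tau> \<le> D * E\<close> and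
      \<open>ln \<tau> \<ge> 1\<close>.\<close>
    have "exp 1 \<le> \<tau>" using False exp_le by linarith
    then have ln\<tau>: "1 \<le> ln \<tau>" using tau ln_ge_iff[of \<tau> 1] by auto
    have "ln \<tau> - ln D = ln (\<tau> / D)" using tau D by (simp add: ln_div)
    also have "\<dots> \<le> ln E" using E tau D by (intro ln_mono) auto
    finally have "ln \<tau> \<le> ln D + ln E" by simp
    then have "1 \<le> (ln D + ln E) / ln \<tau>" using ln\<tau> by simp
    also have "\<dots> = log \<tau> D + ln E / ln \<tau>" by (simp add: log_def add_divide_distrib)
    also have "ln E / ln \<tau> \<le> ln E" using lnE ln\<tau> mult_left_mono[OF ln\<tau> lnE(1)] by (simp add: divide_le_eq)
    also have "ln E \<le> ln E * D" using mult_left_mono[OF D lnE(1)] by simp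
    finally show ?thesis using kD lnE E by (intro that[of "ln E"]) auto
  qed
qed

text \<open>Round \<open>i\<close> has budget \<open>u * y / \<tau> ^ i\<close> and concerns at most
  a fraction \<open>w ^ i\<close> of the voters, so it contributes
  \<open>\<alpha> * (1 - z) * z ^ i\<close> to the domination bound. After \<open>m\<close> such
  rounds and a last one of lowered mean, \<open>\<alpha> * z ^ Suc m\<close> remains for voters
  never satisfied, and everything adds up to \<open>\<alpha>\<close>.\<close>

lemma undominated_many_rounds:
  fixes \<alpha> \<gamma> \<tau> :: real
  assumes t: "2 \<le> t" and al: "0 < \<alpha>" "\<alpha> \<le> 1" and el: "election V A pref" and tA: "t \<le> card A"
    and g: "1 \<le> \<gamma>" and tau: "1 < \<tau>" and z1: "\<tau> * omega \<gamma> t < 1"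
  shows "\<exists>C. undominated V A pref t \<alpha> C \<and>
    real (card C) \<le> (\<gamma> * \<tau> / (\<tau> - 1)) * (1 / (1 - omega \<gamma> t * \<tau>)) * (t / \<alpha>)
                  + log \<tau> ((1 / (1 - omega \<gamma> t * \<tau>)) * (1 / \<alpha>))"
proof -
  define u where "u = \<gamma> * real t"
  define w where "w = chernoff u t"
  define z where "z = w * \<tau>"
  \<comment> \<open>\<open>log \<tau> y\<close> is the logarithmic term of \<open>s1\<close>; it
    pays for the candidate lost to rounding in each round.\<close>
  define y where "y = 1 / (1 - z) * (1 / \<alpha>)"
  have tu: "real t \<le> u" using g t by (simp add: u_def)
  have upos: "0 < u" and u2: "2 \<le> u" using tu t by linarith+
  have fin: "finite A" "finite V" and lin: "\<And>v. v \<in> V \<Longrightarrow> strict_linear_order_on A (pref v)"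
    using el by (auto simp: election_def)
  have w: "omega \<gamma> t = w" using omega_eq_chernoff[OF g t] by (simp add: u_def w_def)
  have wpos: "0 < w" using chernoff_pos[OF t upos] by (simp add: w_def)
  have z: "0 < z" "z < 1" using z1 wpos tau by (auto simp: z_def w mult.commute)
  have ay: "\<alpha> * y = 1 / (1 - z)" using al by (simp add: y_def)
  have "1 * 1 \<le> 1 / (1 - z) * (1 / \<alpha>)" using z al by (intro mult_mono) auto
  then have y1: "1 \<le> y" by (simp add: y_def)
  \<comment> \<open>The number of full rounds. The factor \<open>D\<close> below, between 1 and
    \<open>\<tau>\<close>, scales the budget of the last round.\<close>
  define m where "m = nat \<lfloor>log \<tau> y\<rfloor>"
  have L0: "0 \<le> log \<tau> y" using tau y1 by simp
  have m: "real m \<le> log \<tau> y" "log \<tau> y < real m + 1" using L0 by (auto simp: m_def)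
  have taum: "\<tau> ^ m \<le> y" "y < \<tau> ^ Suc m"
    using m tau y1 le_log_iff[of \<tau> y "real m"] log_less_iff[of \<tau> y "real m + 1"]
    by (auto simp: powr_realpow powr_add mult.commute)
  define D where "D = y / \<tau> ^ m"
  have D1: "1 \<le> D" using taum tau by (simp add: D_def)
  have logD: "log \<tau> y = m + log \<tau> D"
    using tau y1 by (simp add: D_def log_divide log_nat_power)
  \<comment> \<open>\<open>E\<close> is the factor by which the failure rate of the last round may
    exceed \<open>w\<close> within the allowance \<open>\<alpha> * z ^ Suc m\<close>.\<close>
  define E where "E = \<alpha> * \<tau> ^ Suc m"
  have "E = \<tau> / D * (\<alpha> * y)" using tau y1 by (simp add: E_def D_def)
  then have E_eq: "E = \<tau> / D * (1 / (1 - z))" by (simp only: ay)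
  have "\<tau> / D * 1 \<le> E" unfolding E_eq using z tau D1 by (intro mult_left_mono) auto
  then have E1: "\<tau> / D \<le> E" by simp
  have "1 \<le> E"
  proof -
    have "1 \<le> 1 / (1 - z)" using z by simp
    also have "\<dots> = \<alpha> * y" using ay by simp
    also have "\<dots> \<le> E" unfolding E_def using taum al by (intro mult_left_mono) auto
    finally show ?thesis .
  qed
  then obtain s where s: "0 \<le> s" "s \<le> 1" "exp s \<le> E"
    and save: "1 \<le> log \<tau> D + s * D + u * D / (\<tau> - 1)"
    using last_round_saving[OF tau D1 E1 _ u2] by blast
  define B where "B i = u * y / \<tau> ^ i" for i
  have Bpos: "0 < B i" for i using upos y1 tau by (simp add: B_def)
  have tu1: "real t - 1 \<le> u" using tu by simp
  obtain C U where C: "C \<subseteq> A" "real (card C) \<le> (\<Sum>i<m. B i + 1)" "U \<subseteq> V"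
      "card U \<le> w ^ m * card V"
    and dom: "\<And>a. a \<in> A - C \<Longrightarrow> card {v \<in> V - U. \<not> t_beats pref t v C a} \<le>
       (\<Sum>i<m. u / B i * w ^ i) * card V"
    using iterated_rounds[where pref = pref and m = m and B = B, OF fin lin t tu1 Bpos]
    unfolding w_def by blast
  \<comment> \<open>By \<open>s \<le> 1\<close> the lowered mean is still at least
    \<open>t - 1\<close>.\<close>
  have us1: "real t - 1 \<le> u - s" using tu s by simp
  have uspos: "0 < u - s" using us1 t by linarith
  have DB: "0 < (u - s) * D" using uspos D1 by simp
  \<comment> \<open>Mean and budget shrink together: their ratio stays \<open>1 / D\<close>, as in a
    full round, and \<open>s * D\<close> candidates are saved.\<close>
  obtain C' U' where C': "C' \<subseteq> A" "real (card C') < card C + (u - s) * D + 1" "U' \<subseteq> V"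
    "card U' \<le> chernoff (u - s) t * w ^ m * card V"
    "\<And>a. a \<in> A - C' \<Longrightarrow> card {v \<in> V - U'. \<not> t_beats pref t v C' a} \<le>
       ((\<Sum>i<m. u / B i * w ^ i) + (u - s) / ((u - s) * D) * w ^ m) * card V"
    by (rule round_after[OF fin lin t us1 DB C(1,3,4) dom]) auto
  have geo: "(\<Sum>i<m. u / B i * w ^ i) = \<alpha> * (1 - z ^ m)"
  proof -
    have "(\<Sum>i<m. u / B i * w ^ i) = (\<Sum>i<m. z ^ i) / y"
      unfolding sum_divide_distrib B_def z_def using upos by (simp add: power_mult_distrib mult_ac)
    also have "\<dots> = \<alpha> * (1 - z ^ m)"
      using z al by (simp add: y_def sum_gp_strict)
    finally show ?thesis .
  qed
  have "(u - s) / ((u - s) * D) * w ^ m = z ^ m / y"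
    using uspos by (simp add: D_def z_def power_mult_distrib)
  also have "\<dots> = \<alpha> * (z ^ m - z ^ Suc m)" using z al by (simp add: y_def algebra_simps)
  finally have last: "(u - s) / ((u - s) * D) * w ^ m = \<alpha> * (z ^ m - z ^ Suc m)" .
  have "chernoff (u - s) t \<le> exp s * w"
    unfolding w_def using t s uspos by (intro chernoff_shift) auto
  also have "\<dots> \<le> E * w" using s wpos by simp
  finally have "chernoff (u - s) t * w ^ m \<le> E * w * w ^ m" using wpos by simp
  also have "\<dots> = \<alpha> * z ^ Suc m" by (simp add: E_def z_def power_mult_distrib)
  finally have rest: "chernoff (u - s) t * w ^ m \<le> \<alpha> * z ^ Suc m" .
  let ?K = "(\<gamma> * \<tau> / (\<tau> - 1)) * (1 / (1 - omega \<gamma> t * \<tau>)) * (t / \<alpha>)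
                  + log \<tau> ((1 / (1 - omega \<gamma> t * \<tau>)) * (1 / \<alpha>))"
  have K: "?K = u * y * (\<tau> / (\<tau> - 1)) + log \<tau> y"
    unfolding w z_def[symmetric] y_def u_def by (simp add: mult_ac)
  \<comment> \<open>The finite sum falls short of the geometric series by
    \<open>u * D / (\<tau> - 1)\<close>, the tail that enters \<open>save\<close>.\<close>
  have "(\<Sum>i<Suc m. B i) = u * y * (\<tau> / (\<tau> - 1)) - u * D / (\<tau> - 1)"
  proof -
    have "(\<Sum>i<Suc m. B i) = u * y * (\<Sum>i<Suc m. (1 / \<tau>) ^ i)"
      unfolding sum_distrib_left B_def by (simp add: power_one_over)
    also have "(\<Sum>i<Suc m. (1 / \<tau>) ^ i) = (1 - (1 / \<tau>) ^ Suc m) / (1 - 1 / \<tau>)"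
      using tau by (subst sum_gp_strict) auto
    also have "\<dots> = (\<tau> - \<tau> * (1 / \<tau>) ^ Suc m) / (\<tau> - 1)"
      using tau by (simp add: divide_simps)
    also have "\<dots> = \<tau> / (\<tau> - 1) - 1 / \<tau> ^ m / (\<tau> - 1)"
      using tau by (simp add: diff_divide_distrib power_one_over)
    finally show ?thesis by (simp add: D_def algebra_simps)
  qed
  moreover have "B m = u * D" by (simp add: B_def D_def)
  moreover have "(\<Sum>i<m. B i + 1) = (\<Sum>i<m. B i) + m" by (simp add: sum.distrib)
  ultimately have "real (card C') \<le> u * y * (\<tau> / (\<tau> - 1)) - u * D / (\<tau> - 1) - s * D + m + 1"
    using C'(2) C(2) by (simp add: algebra_simps)
  then have cardK: "real (card C') \<le> ?K" unfolding K logD using save by linarith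
  have "u * 1 \<le> u * y * (\<tau> / (\<tau> - 1))"
    unfolding mult.assoc using upos y1 tau mult_mono[of 1 y 1 "\<tau> / (\<tau> - 1)"]
    by (intro mult_left_mono) auto
  then have tK: "real t \<le> ?K" unfolding K using tu L0 by linarith
  have "\<alpha> * (1 - z ^ m) + \<alpha> * (z ^ m - z ^ Suc m) + chernoff (u - s) t * w ^ m \<le> \<alpha>"
    using rest by (simp add: algebra_simps)
  then show ?thesis
    using undominated_from_partial[OF el tA C'(1,3,4) _ _ tK cardK, 
      of "\<alpha> * (1 - z ^ m) + \<alpha> * (z ^ m - z ^ Suc m)" \<alpha>] C'(5)
    unfolding geo last by blast
qed

section \<open>The bounds on delta\<close>

lemma omega_pos: "1 \<le> \<gamma> \<Longrightarrow> 2 \<le> t \<Longrightarrow> 0 < omega \<gamma> t"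
  by (simp add: omega_eq_chernoff chernoff_pos)

text \<open>In the Chernoff form the power of \<open>t / (t - 1)\<close> is at most
  \<open>exp 1\<close>; what remains is geometric in \<open>t\<close>.\<close>

lemma omega_le:
  assumes g: "1 \<le> \<gamma>" and t: "2 \<le> t"
  shows "omega \<gamma> t \<le> (\<gamma> * exp (1 - \<gamma>)) ^ t / \<gamma>"
proof -
  obtain m where m: "t = Suc m" "m \<noteq> 0" using t by (cases t) auto
  have "((1 + real m) / real m) ^ m = (1 + 1 / real m) ^ m"
    using m by (simp add: add_divide_distrib add.commute)
  also have "\<dots> \<le> exp (1 / real m) ^ m"
    by (intro power_mono) auto
  also have "\<dots> = exp 1" using m by (simp add: exp_of_nat_mult[symmetric])
  finally have *: "((1 + real m) / real m) ^ m \<le> exp 1" .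
  have "omega \<gamma> t = exp (- (\<gamma> * (1 + m) - m)) * (\<gamma> ^ m * ((1 + real m) / real m) ^ m)"
    using omega_eq_chernoff[OF g t] by (simp add: chernoff_def m power_mult_distrib[symmetric])
  also have "\<dots> \<le> exp (- (\<gamma> * (1 + m) - m)) * (\<gamma> ^ m * exp 1)"
    using * g by (intro mult_left_mono) auto
  also have "\<dots> = \<gamma> ^ m * exp (real t * (1 - \<gamma>))"
    by (simp add: m exp_add[symmetric] algebra_simps)
  also have "\<dots> = (\<gamma> * exp (1 - \<gamma>)) ^ t / \<gamma>"
    unfolding exp_of_nat_mult using g by (simp add: m power_mult_distrib)
  finally show ?thesis .
qed

lemma gamma_exp_less_1:
  fixes \<gamma> :: real
  assumes "1 < \<gamma>"
  shows "\<gamma> * exp (1 - \<gamma>) < 1"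
proof -
  have "ln \<gamma> < \<gamma> - 1"
    using assms ln_le_minus_one[of \<gamma>] ln_eq_minus_one[of \<gamma>] by fastforce
  then have "exp (ln \<gamma>) < exp (\<gamma> - 1)" by simp
  then show ?thesis using assms by (simp add: exp_diff field_simps)
qed

lemma exp_one_lower: "2.718 \<le> exp (1::real)"
proof -
  \<comment> \<open>Seven terms of the exponential series give 1957/720, just above 2.718.\<close>
  have "(\<Sum>n<7. (1::real) ^ n /\<^sub>R fact n) \<le> (\<Sum>n. 1 ^ n /\<^sub>R fact n)"
    using exp_converges[of "1::real"] by (intro sum_le_suminf) (auto simp: sums_iff)
  also have "\<dots> = exp 1" using exp_converges[of "1::real"] by (simp add: sums_iff)
  finally show ?thesis by (simp add: eval_nat_numeral)
qed

lemma exp_nat_lower: "2.718 ^ n \<le> exp (real n)"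
  using power_mono[OF exp_one_lower, of n] exp_of_nat_mult[of n "1::real"] by simp

text \<open>The base \<open>\<gamma> * exp (1 - \<gamma>)\<close> is below 1, so
  \<open>t = 3\<close> is the worst case. For \<open>t = 2\<close> the estimate
  \<open>omega_le\<close> is too weak for the constants below, and the exact
  \<open>omega_two\<close> takes over.\<close>

lemma omega_le_of_large_t:
  assumes "1 < \<gamma>" and "3 \<le> t"
  shows "omega \<gamma> t \<le> \<gamma>\<^sup>2 * exp (3 - 3 * \<gamma>)"
proof -
  have "omega \<gamma> t \<le> (\<gamma> * exp (1 - \<gamma>)) ^ t / \<gamma>" using assms by (intro omega_le) auto
  also have "\<dots> \<le> (\<gamma> * exp (1 - \<gamma>)) ^ 3 / \<gamma>"
    using assms gamma_exp_less_1[OF assms(1)]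
    by (intro divide_right_mono power_decreasing) auto
  also have "\<dots> = \<gamma>\<^sup>2 * exp (1 - \<gamma>) ^ 3"
    using assms by (simp add: power_mult_distrib power2_eq_square power3_eq_cube)
  also have "exp (1 - \<gamma>) ^ 3 = exp (3 - 3 * \<gamma>)"
    using exp_of_nat_mult[of 3 "1 - \<gamma>"] by (simp add: algebra_simps)
  finally show ?thesis .
qed

lemma omega_two: "1 \<le> \<gamma> \<Longrightarrow> omega \<gamma> 2 = 2 * \<gamma> * exp (1 - 2 * \<gamma>)"
  by (simp add: omega_eq_chernoff chernoff_def algebra_simps)

lemma omega_seven_halves:
  assumes "2 \<le> t"
  shows "omega (7/2) t \<le> 0.0175"
proof (cases "t = 2")
  case True
  \<comment> \<open>For \<open>t = 2\<close> the value is \<open>7 * exp (- 6)\<close>, and 0.0175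
    is 7/400.\<close>
  have "400 \<le> exp (6::real)"
    using exp_nat_lower[of 6] by (simp add: power_divide)
  then have "exp (- 6 :: real) \<le> 1 / 400" by (simp add: exp_minus field_simps)
  then show ?thesis using omega_two[of "7/2"] by (simp add: True)
next
  case False
  have "1000 \<le> exp (7::real)"
    using exp_nat_lower[of 7] by (simp add: power_divide)
  then have "exp (- 7 :: real) \<le> 1 / 1000" by (simp add: exp_minus field_simps)
  then have "exp (- (15/2) :: real) \<le> 1 / 1000"
    by (rule order_trans[rotated]) simp
  moreover have "omega (7/2) t \<le> (7/2)\<^sup>2 * exp (3 - 3 * (7/2))"
    using False assms by (intro omega_le_of_large_t) auto
  moreover have "3 - 3 * (7/2) = - (15/2 :: real)" by simp
  ultimately show ?thesis by (simp add: power2_eq_square)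
qed

lemma omega_four:
  assumes "2 \<le> t"
  shows "omega 4 t \<le> 0.0074"
proof -
  \<comment> \<open>1082 is the least integer with \<open>8 / 1082 \<le> 0.0074\<close>; both cases
    below reduce to 8/1082.\<close>
  have "1082 \<le> exp (7::real)"
    using exp_nat_lower[of 7] by (simp add: power_divide)
  then have 7: "exp (- 7 :: real) \<le> 1 / 1082" by (simp add: exp_minus field_simps)
  show ?thesis
  proof (cases "t = 2")
    case True
    then show ?thesis using omega_two[of 4] 7 by simp
  next
    case False
    have "exp (- 9 :: real) = exp (- 7) * exp (- 2)" by (simp add: exp_add[symmetric])
    also have "exp (- 2 :: real) \<le> 1 / 2"
      using exp_nat_lower[of 2] by (simp add: exp_minus field_simps)
    finally have "exp (- 9 :: real) \<le> exp (- 7) * (1 / 2)" by simp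
    moreover have "omega 4 t \<le> 4\<^sup>2 * exp (3 - 3 * 4)"
      using False assms by (intro omega_le_of_large_t) auto
    ultimately show ?thesis using 7 by simp
  qed
qed

lemma log_nonneg: "1 < b \<Longrightarrow> 1 \<le> x \<Longrightarrow> 0 \<le> log b x"
  by simp

section \<open>Working with the infima s1 and s2\<close>

lemma s1_le:
  assumes t: "2 \<le> t" and al: "0 < \<alpha>" "\<alpha> \<le> 1"
    and g: "1 \<le> \<gamma>" "1 < \<tau>" "\<tau> * omega \<gamma> t < 1"
  shows "s1 \<alpha> t \<le> (\<gamma> * \<tau> / (\<tau> - 1)) * (1 / (1 - omega \<gamma> t * \<tau>)) * (t / \<alpha>)
                  + log \<tau> ((1 / (1 - omega \<gamma> t * \<tau>)) * (1 / \<alpha>))"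
  unfolding s1_def
proof (rule cInf_lower)
  have "0 \<le> (\<gamma> * \<tau> / (\<tau> - 1)) * (1 / (1 - omega \<gamma> t * \<tau>)) * (t / \<alpha>)
                  + log \<tau> ((1 / (1 - omega \<gamma> t * \<tau>)) * (1 / \<alpha>))"
    if h: "1 \<le> \<gamma>" "1 < \<tau>" "\<tau> * omega \<gamma> t < 1" for \<gamma> \<tau> :: real
  proof -
    have "0 \<le> omega \<gamma> t * \<tau>" "omega \<gamma> t * \<tau> < 1"
      using h omega_pos[OF h(1) t] by (auto simp: mult.commute)
    \<comment> \<open>The argument of the logarithm is at least 1, which makes 0 a lower bound of
      the set.\<close>
    then have "1 * 1 \<le> 1 / (1 - omega \<gamma> t * \<tau>) * (1 / \<alpha>)"
      using al by (intro mult_mono) auto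
    then have "0 \<le> log \<tau> (1 / (1 - omega \<gamma> t * \<tau>) * (1 / \<alpha>))"
      unfolding mult_1 by (rule log_nonneg[OF h(2)])
    moreover have "0 \<le> (\<gamma> * \<tau> / (\<tau> - 1)) * (1 / (1 - omega \<gamma> t * \<tau>)) * (t / \<alpha>)"
      using h al by (intro mult_nonneg_nonneg) (auto simp: mult.commute)
    ultimately show ?thesis by linarith
  qed
  then show "bdd_below {(\<gamma> * \<tau> / (\<tau> - 1)) * (1 / (1 - omega \<gamma> t * \<tau>)) * (t / \<alpha>)
                  + log \<tau> ((1 / (1 - omega \<gamma> t * \<tau>)) * (1 / \<alpha>)) | \<gamma> \<tau>.
                 \<gamma> \<ge> 1 \<and> \<tau> > 1 \<and> \<tau> * omega \<gamma> t < 1}"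
    by (intro bdd_belowI[of _ 0]) blast
qed (use g in blast)

lemma s1_ge:
  assumes t: "2 \<le> t"
    and ge: "\<And>\<gamma> \<tau>. 1 \<le> \<gamma> \<Longrightarrow> 1 < \<tau> \<Longrightarrow> \<tau> * omega \<gamma> t < 1 \<Longrightarrow>
      c \<le> (\<gamma> * \<tau> / (\<tau> - 1)) * (1 / (1 - omega \<gamma> t * \<tau>)) * (t / \<alpha>)
                  + log \<tau> ((1 / (1 - omega \<gamma> t * \<tau>)) * (1 / \<alpha>))"
  shows "c \<le> s1 \<alpha> t"
  unfolding s1_def
proof (rule cInf_greatest)
  \<comment> \<open>Nonemptiness of the set: \<open>8 * 0.0175 < 1\<close>.\<close>
  have "1 \<le> (7/2::real) \<and> 1 < (8::real) \<and> 8 * omega (7/2) t < 1" 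
    using omega_seven_halves[OF t] by simp
  then have "\<exists>\<gamma> \<tau>. \<gamma> \<ge> 1 \<and> \<tau> > 1 \<and> \<tau> * omega \<gamma> t < 1" by blast
  then show "{(\<gamma> * \<tau> / (\<tau> - 1)) * (1 / (1 - omega \<gamma> t * \<tau>)) * (t / \<alpha>)
                  + log \<tau> ((1 / (1 - omega \<gamma> t * \<tau>)) * (1 / \<alpha>)) | \<gamma> \<tau>.
                 \<gamma> \<ge> 1 \<and> \<tau> > 1 \<and> \<tau> * omega \<gamma> t < 1} \<noteq> {}"
    by simp blast
next
  fix x
  assume "x \<in> {(\<gamma> * \<tau> / (\<tau> - 1)) * (1 / (1 - omega \<gamma> t * \<tau>)) * (t / \<alpha>)
                  + log \<tau> ((1 / (1 - omega \<gamma> t * \<tau>)) * (1 / \<alpha>)) | \<gamma> \<tau>.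
                 \<gamma> \<ge> 1 \<and> \<tau> > 1 \<and> \<tau> * omega \<gamma> t < 1}"
  then show "c \<le> x" by (elim CollectE exE conjE) (simp only: ge)
qed

text \<open>Scaling by \<open>\<alpha> / t\<close> makes the main term independent of
  \<open>\<alpha>\<close>; the logarithms are divided by \<open>t\<close>.\<close>

lemma scaled_s1_le:
  assumes t: "2 \<le> t" and al: "0 < \<alpha>" "\<alpha> \<le> 1"
    and g: "1 \<le> \<gamma>" "1 < \<tau>" "\<tau> * omega \<gamma> t < 1"
  shows "\<alpha> * s1 \<alpha> t / t \<le> (\<gamma> * \<tau> / (\<tau> - 1)) * (1 / (1 - omega \<gamma> t * \<tau>))
      + (\<alpha> * log \<tau> (1 / (1 - omega \<gamma> t * \<tau>)) + \<alpha> * log \<tau> (1 / \<alpha>)) / t"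
proof -
  define K where "K = 1 / (1 - omega \<gamma> t * \<tau>)"
  have K: "0 < K" using g by (simp add: K_def mult.commute)
  have "\<alpha> * s1 \<alpha> t / t \<le> \<alpha> * ((\<gamma> * \<tau> / (\<tau> - 1)) * K * (t / \<alpha>) + log \<tau> (K * (1 / \<alpha>))) / t"
    using s1_le[OF t al g] al t unfolding K_def
    by (intro divide_right_mono mult_left_mono) auto
  also have "\<dots> = (\<gamma> * \<tau> / (\<tau> - 1)) * K + (\<alpha> * log \<tau> K + \<alpha> * log \<tau> (1 / \<alpha>)) / t"
    using K al g t by (subst log_mult) (auto simp: field_simps)
  finally show ?thesis unfolding K_def .
qed

lemma s2_le:
  fixes \<alpha> \<gamma> :: real
  assumes t: "2 \<le> t" and g: "1 \<le> \<gamma>" "omega \<gamma> t < \<alpha>"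
  shows "s2 \<alpha> t \<le> \<gamma> * t / (\<alpha> - omega \<gamma> t) + 1"
proof -
  define q where "q = \<gamma> * t / (\<alpha> - omega \<gamma> t)"
  have q: "0 < q" using g t by (simp add: q_def)
  define B where "B = nat \<lceil>q\<rceil>"
  have B: "q \<le> real B" "real B \<le> q + 1" "1 \<le> B" using q by (auto simp: B_def; linarith)+
  have "\<gamma> * t / B \<le> \<alpha> - omega \<gamma> t" using B g by (simp add: q_def field_simps)
  then have "Inf {B :: nat. B \<ge> 1 \<and> (\<exists>\<gamma> \<ge> (1::real). \<alpha> \<ge> \<gamma> * t / B + omega \<gamma> t)} \<le> B"
    using g B by (intro wellorder_Inf_le1 CollectI conjI exI[of _ \<gamma>]) auto
  then show ?thesis unfolding s2_def using B(2) by (simp add: q_def)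
qed

text \<open>A nonempty set of naturals contains its infimum. The given \<open>\<gamma>\<close>
  supplies a member, while the optimal \<open>B\<close> may come with another
  \<open>\<gamma>'\<close>.\<close>

lemma s2_attained:
  fixes \<alpha> \<gamma> :: real
  assumes t: "2 \<le> t" and g: "1 \<le> \<gamma>" "omega \<gamma> t < \<alpha>"
  obtains B \<gamma>' where "s2 \<alpha> t = real B" "1 \<le> B" "1 \<le> \<gamma>'" "\<gamma>' * t / B + omega \<gamma>' t \<le> \<alpha>"
proof -
  let ?S = "{B :: nat. B \<ge> 1 \<and> (\<exists>\<gamma> \<ge> (1::real). \<alpha> \<ge> \<gamma> * t / B + omega \<gamma> t)}"
  obtain B :: nat where B: "\<gamma> * t / (\<alpha> - omega \<gamma> t) \<le> B" using real_arch_simple by blast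
  have "0 < \<gamma> * t / (\<alpha> - omega \<gamma> t)" using g t by simp
  then have "0 < B" using B by linarith
  then have "\<gamma> * t / B + omega \<gamma> t \<le> \<alpha>" using B g by (simp add: field_simps)
  then have "B \<in> ?S" using \<open>0 < B\<close> g by auto
  then have "Inf ?S \<in> ?S" by (intro Inf_nat_def1) blast
  then show ?thesis using that[of "Inf ?S"] unfolding s2_def by auto
qed

lemma exists_omega_less:
  fixes \<alpha> :: real
  assumes t: "2 \<le> t" and al: "0 < \<alpha>"
  obtains \<gamma> where "1 \<le> \<gamma>" "omega \<gamma> t < \<alpha>"
proof -
  \<comment> \<open>Chosen because \<open>omega \<gamma> t \<le> 1 / \<gamma>\<close> and
    \<open>\<alpha> * \<gamma> = 2 * \<alpha> + 1\<close> exceeds 1.\<close>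
  define \<gamma> where "\<gamma> = 2 + 1 / \<alpha>"
  have g: "1 < \<gamma>" using al by (simp add: \<gamma>_def add_pos_pos)
  have "omega \<gamma> t \<le> (\<gamma> * exp (1 - \<gamma>)) ^ t / \<gamma>" using g t by (intro omega_le) auto
  also have "\<dots> \<le> 1 / \<gamma>"
    using g gamma_exp_less_1[OF g] by (intro divide_right_mono power_le_one) auto
  also have "\<dots> < \<alpha>"
  proof -
    have "\<alpha> * \<gamma> = 2 * \<alpha> + 1" using al by (simp add: \<gamma>_def distrib_left)
    then show ?thesis using al g by (simp add: pos_divide_less_eq)
  qed
  finally show ?thesis using g by (intro that[of \<gamma>]) auto
qed

section \<open>The upper bound 4.75\<close>

lemma scaled_min_le:
  assumes t: "2 \<le> t" and al: "0 < \<alpha>" "\<alpha> \<le> 1"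
  shows "min (\<alpha> * s1 \<alpha> t / t) (\<alpha> * s2 \<alpha> t / t) \<le> 4.75"
proof (cases "\<alpha> \<le> 1 / 16")
  case True
  \<comment> \<open>For \<open>\<gamma> = 7/2\<close> and \<open>\<tau> = 8\<close> the factor
    \<open>\<gamma> * \<tau> / (\<tau> - 1)\<close> is 4, its correction is at most
    \<open>1 / (1 - 0.14) = 50 / 43\<close>, and the logarithms add at most 7/96.\<close>
  define w where "w = omega (7/2) t"
  have w: "0 < w" "w \<le> 0.0175" unfolding w_def using omega_pos[of "7/2" t] omega_seven_halves t by auto
  have K: "1 / (1 - w * 8) \<le> 50 / 43" "1 \<le> 1 / (1 - w * 8)" using w by (auto simp: field_simps)
  have "log 8 (1 / (1 - w * 8)) \<le> log 8 8" using K w by (intro log_mono) auto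
  then have l1: "\<alpha> * log 8 (1 / (1 - w * 8)) \<le> 1 / 16 * 1"
    using al True log_nonneg[OF _ K(2), of 8] by (intro mult_mono) auto
  have "\<alpha> * log 8 (1 / \<alpha>) \<le> 1 / 12"
  proof -
    have ln8: "0 < ln (8::real)" by simp
    \<comment> \<open>Splitting off 16 makes the estimate sharp at the endpoint
      \<open>\<alpha> = 1 / 16\<close>, where the value is 1/12.\<close>
    have "log 8 (1 / \<alpha>) = log 8 (16 * (1 / (16 * \<alpha>)))" using al by simp
    also have "\<dots> = log 8 16 + log 8 (1 / (16 * \<alpha>))" using al by (subst log_mult) auto
    also have "log 8 16 = (4 / 3 :: real)"
    proof -
      have "ln (16::real) = 4 * ln 2" "ln (8::real) = 3 * ln 2"
        using ln_realpow[of 2 4] ln_realpow[of 2 3] by auto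
      then show ?thesis by (simp add: log_def)
    qed
    also have "log 8 (1 / (16 * \<alpha>)) \<le> (1 / (16 * \<alpha>) - 1) / ln 8"
      unfolding log_def using al ln8 by (intro divide_right_mono ln_le_minus_one) auto
    also have "\<dots> \<le> (1 / (16 * \<alpha>) - 1) / 1"
    proof (rule divide_left_mono)
      have "exp 1 \<le> (8::real)" using exp_le by linarith
      then show "1 \<le> ln (8::real)" by (simp add: ln_ge_iff)
      show "0 \<le> 1 / (16 * \<alpha>) - 1" using al True by (simp add: field_simps)
    qed auto
    finally have "\<alpha> * log 8 (1 / \<alpha>) \<le> \<alpha> * (4 / 3 + (1 / (16 * \<alpha>) - 1))"
      using al by (intro mult_left_mono) auto
    also have "\<dots> = \<alpha> / 3 + 1 / 16" using al by (simp add: field_simps)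
    also have "\<dots> \<le> 1 / 12" using True by simp
    finally show ?thesis .
  qed
  then have "\<alpha> * log 8 (1 / (1 - w * 8)) + \<alpha> * log 8 (1 / \<alpha>) \<le> 7 / 48" using l1 by simp
  moreover have "0 \<le> \<alpha> * log 8 (1 / (1 - w * 8)) + \<alpha> * log 8 (1 / \<alpha>)"
    using al log_nonneg[OF _ K(2), of 8] by (intro add_nonneg_nonneg mult_nonneg_nonneg) auto
  ultimately have "(\<alpha> * log 8 (1 / (1 - w * 8)) + \<alpha> * log 8 (1 / \<alpha>)) / t \<le> (7 / 48) / 2"
    using t by (intro frac_le) auto
  moreover have "\<alpha> * s1 \<alpha> t / t \<le> (7/2 * 8 / (8 - 1)) * (1 / (1 - w * 8))
      + (\<alpha> * log 8 (1 / (1 - w * 8)) + \<alpha> * log 8 (1 / \<alpha>)) / t"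
    unfolding w_def by (rule scaled_s1_le[OF t al]) (use w in \<open>auto simp: w_def\<close>)
  moreover have "(7/2 * 8 / (8 - 1)) * (1 / (1 - w * 8)) \<le> 4 * (50 / 43)"
    using K by simp
  ultimately have "\<alpha> * s1 \<alpha> t / t \<le> 4 * (50 / 43) + (7 / 48) / 2" by linarith
  also have "\<dots> \<le> 4.75" by simp
  finally show ?thesis by (rule min.coboundedI1)
next
  case False
  define w where "w = omega 4 t"
  have w: "0 < w" "w \<le> 0.0074" unfolding w_def using omega_pos[of 4 t] omega_four t by auto
  have aw: "w < \<alpha>" using w False by simp
  have "s2 \<alpha> t \<le> 4 * t / (\<alpha> - w) + 1"
    unfolding w_def using s2_le[OF t, of 4] aw by (simp add: w_def)
  then have "\<alpha> * s2 \<alpha> t / t \<le> \<alpha> * (4 * t / (\<alpha> - w) + 1) / t"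
    using al by (intro divide_right_mono mult_left_mono) auto
  also have "\<dots> = 4 * \<alpha> / (\<alpha> - w) + \<alpha> / t" using t aw by (simp add: field_simps)
  also have "\<alpha> / t \<le> \<alpha> / 2" using t al by (intro divide_left_mono) auto
  also have "4 * \<alpha> / (\<alpha> - w) + \<alpha> / 2 \<le> 4.75"
  proof -
    \<comment> \<open>Convexity: between 1/16 and 1 the square lies below its chord, which turns the
      quadratic inequality into a linear one.\<close>
    have "0 \<le> (16 * \<alpha> - 1) * (1 - \<alpha>)" using False al by (intro mult_nonneg_nonneg) auto
    then have sq: "\<alpha> * \<alpha> \<le> 17 / 16 * \<alpha> - 1 / 16" by (simp add: algebra_simps)
    have "4 * \<alpha> + \<alpha> / 2 * (\<alpha> - w) \<le> 4 * \<alpha> + \<alpha> * \<alpha> / 2"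
      using al w by (simp add: algebra_simps)
    also have "\<dots> \<le> 4.75 * (\<alpha> - w)" using sq w False by simp
    finally have "(4 * \<alpha> + \<alpha> / 2 * (\<alpha> - w)) / (\<alpha> - w) \<le> 4.75" using aw by (simp add: field_simps)
    moreover have "4 * \<alpha> / (\<alpha> - w) + \<alpha> / 2 = (4 * \<alpha> + \<alpha> / 2 * (\<alpha> - w)) / (\<alpha> - w)"
      using aw by (simp add: add_divide_distrib del: times_divide_eq_left)
    ultimately show ?thesis by simp
  qed
  finally show ?thesis by linarith
qed

lemma delta_le: "2 \<le> t \<Longrightarrow> delta t \<le> 4.75"
  unfolding delta_def using scaled_min_le by (intro cSUP_least) auto

lemma le_delta:
  assumes "2 \<le> t" "0 < \<alpha>" "\<alpha> \<le> 1"
  shows "min (\<alpha> * s1 \<alpha> t / t) (\<alpha> * s2 \<alpha> t / t) \<le> delta t"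
  unfolding delta_def using assms scaled_min_le
  by (intro cSUP_upper bdd_aboveI2[where M = "4.75"]) auto

section \<open>The strict lower bound for delta\<close>

lemma s1_one_gt:
  assumes t: "2 \<le> t"
  shows "real t < s1 1 t"
proof -
  \<comment> \<open>Values above \<open>t\<close> could still have infimum \<open>t\<close>, so a
    uniform gap is needed: \<open>w\<close> bounds \<open>omega \<gamma> t\<close> from below for
    \<open>\<gamma> < 2\<close>, and from 2 on the factor \<open>\<gamma>\<close> alone
    suffices.\<close>
  define w where "w = exp (- (real t + 1))"
  have w: "0 < w" "w < 1" by (auto simp: w_def)
  have "(1 + w) * t \<le> s1 1 t"
  proof (rule s1_ge[OF t])
    fix \<gamma> \<tau> :: real
    assume h: "1 \<le> \<gamma>" "1 < \<tau>" "\<tau> * omega \<gamma> t < 1"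
    define K where "K = 1 / (1 - omega \<gamma> t * \<tau>)"
    have o: "0 < omega \<gamma> t" using omega_pos[OF h(1) t] .
    have o\<tau>: "omega \<gamma> t * \<tau> < 1" "omega \<gamma> t \<le> omega \<gamma> t * \<tau>" using h o by (auto simp: mult.commute)
    have K1: "1 \<le> K" using o o\<tau> by (simp add: K_def)
    have \<tau>1: "1 \<le> \<tau> / (\<tau> - 1)" using h by simp
    have "1 + w \<le> \<gamma> * K"
    proof (cases "2 \<le> \<gamma>")
      case True
      then have "2 * 1 \<le> \<gamma> * K" using K1 by (intro mult_mono) auto
      then show ?thesis using w by simp
    next
      case False
      define u where "u = \<gamma> * t"
      have "u \<le> 2 * t" "real t \<le> u" using False h t by (auto simp: u_def)
      then have "w * 1 \<le> chernoff u t" unfolding chernoff_def w_def using t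
        by (intro mult_mono one_le_power) auto
      then have "w \<le> omega \<gamma> t" using omega_eq_chernoff[OF h(1) t] by (simp add: u_def)
      then have "w \<le> omega \<gamma> t * \<tau>" using o\<tau>(2) by (rule order_trans)
      then have "1 / (1 - w) \<le> K" unfolding K_def using o\<tau> w by (intro divide_left_mono) auto
      moreover have "1 + w \<le> 1 / (1 - w)" using w by (simp add: field_simps)
      moreover have "1 * K \<le> \<gamma> * K" using h K1 by (intro mult_right_mono) auto
      ultimately show ?thesis by linarith
    qed
    then have "(1 + w) * 1 \<le> (\<gamma> * K) * (\<tau> / (\<tau> - 1))"
      using \<tau>1 h K1 by (intro mult_mono) auto
    then have "(1 + w) * t \<le> \<gamma> * K * (\<tau> / (\<tau> - 1)) * t" by (intro mult_right_mono) auto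
    moreover have "0 \<le> log \<tau> K" using K1 h by (subst zero_le_log_cancel_iff) auto
    ultimately show "(1 + w) * t \<le> (\<gamma> * \<tau> / (\<tau> - 1)) * (1 / (1 - omega \<gamma> t * \<tau>)) * (t / 1)
                  + log \<tau> ((1 / (1 - omega \<gamma> t * \<tau>)) * (1 / 1))"
      unfolding K_def[symmetric] by (simp add: mult_ac)
  qed
  moreover have "real t < (1 + w) * t" using w t by (simp add: algebra_simps)
  ultimately show ?thesis by linarith
qed

text \<open>Here the infimum is attained, so positivity of \<open>omega\<close> gives strictness at
  once.\<close>

lemma s2_one_gt:
  assumes t: "2 \<le> t"
  shows "real t < s2 1 t"
proof -
  obtain \<gamma>0 where "1 \<le> \<gamma>0" "omega \<gamma>0 t < 1" by (rule exists_omega_less[OF t zero_less_one])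
  then obtain B and \<gamma> :: real where B: "s2 1 t = real B" "1 \<le> B" "1 \<le> \<gamma>" "\<gamma> * t / B + omega \<gamma> t \<le> 1"
    by (rule s2_attained[OF t])
  have "\<gamma> * t / B < 1" using B omega_pos[OF B(3) t] by linarith
  then have "\<gamma> * t < B" using B by (simp add: field_simps)
  moreover have "1 * real t \<le> \<gamma> * t" using B by (intro mult_right_mono) auto
  ultimately show ?thesis using B by simp
qed

lemma delta_gt_1:
  assumes t: "2 \<le> t"
  shows "1 < delta t"
proof -
  have "1 < min (1 * s1 1 t / t) (1 * s2 1 t / t)"
    using s1_one_gt[OF t] s2_one_gt[OF t] t by simp
  also have "\<dots> \<le> delta t" using t by (intro le_delta) auto
  finally show ?thesis .
qed

section \<open>The limit of delta\<close>

lemma omega_tendsto_0: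
  assumes g: "1 < \<gamma>"
  shows "(\<lambda>t. omega \<gamma> t) \<longlonglongrightarrow> 0"
proof (rule tendsto_sandwich)
  show "\<forall>\<^sub>F t in sequentially. 0 \<le> omega \<gamma> t"
    using eventually_ge_at_top[of 2] by eventually_elim (use g omega_pos in \<open>simp add: less_imp_le\<close>)
  show "\<forall>\<^sub>F t in sequentially. omega \<gamma> t \<le> (\<gamma> * exp (1 - \<gamma>)) ^ t / \<gamma>"
    using eventually_ge_at_top[of 2] by eventually_elim (use g omega_le in simp)
  have "(\<lambda>t. (\<gamma> * exp (1 - \<gamma>)) ^ t) \<longlonglongrightarrow> 0"
    using g gamma_exp_less_1[OF g] by (intro LIMSEQ_power_zero) auto
  then show "(\<lambda>t. (\<gamma> * exp (1 - \<gamma>)) ^ t / \<gamma>) \<longlonglongrightarrow> 0"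
    using tendsto_divide_zero by blast
qed auto

text \<open>The \<open>s1\<close> branch alone suffices;
  \<open>\<alpha> * ln (1 / \<alpha>) \<le> 1\<close> makes its bound uniform in
  \<open>\<alpha>\<close>.\<close>

lemma delta_le_asymptotic:
  assumes t: "2 \<le> t" and g: "1 \<le> \<gamma>" "1 < \<tau>" "\<tau> * omega \<gamma> t < 1"
  shows "delta t \<le> (\<gamma> * \<tau> / (\<tau> - 1)) * (1 / (1 - omega \<gamma> t * \<tau>))
      + (log \<tau> (1 / (1 - omega \<gamma> t * \<tau>)) + 1 / ln \<tau>) / t"
  unfolding delta_def
proof (rule cSUP_least)
  fix \<alpha> :: real assume "\<alpha> \<in> {0<..1}"
  then have al: "0 < \<alpha>" "\<alpha> \<le> 1" by auto
  define K where "K = 1 / (1 - omega \<gamma> t * \<tau>)"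
  have "1 \<le> K" using g omega_pos[OF g(1) t] by (simp add: K_def mult.commute)
  then have "0 \<le> log \<tau> K" using g by (subst zero_le_log_cancel_iff) auto
  then have "\<alpha> * log \<tau> K \<le> 1 * log \<tau> K" using al by (intro mult_right_mono) auto
  moreover have "\<alpha> * log \<tau> (1 / \<alpha>) \<le> 1 / ln \<tau>"
  proof -
    have "\<alpha> * ln (1 / \<alpha>) \<le> \<alpha> * (1 / \<alpha> - 1)"
      using al by (intro mult_left_mono ln_le_minus_one) auto
    also have "\<dots> \<le> 1" using al by (simp add: algebra_simps)
    finally have "\<alpha> * ln (1 / \<alpha>) / ln \<tau> \<le> 1 / ln \<tau>" using g by (intro divide_right_mono) auto
    then show ?thesis by (simp add: log_def)
  qed
  ultimately have "(\<alpha> * log \<tau> K + \<alpha> * log \<tau> (1 / \<alpha>)) / t \<le> (log \<tau> K + 1 / ln \<tau>) / t"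
    by (intro divide_right_mono) auto
  then show "min (\<alpha> * s1 \<alpha> t / t) (\<alpha> * s2 \<alpha> t / t) \<le> (\<gamma> * \<tau> / (\<tau> - 1)) * (1 / (1 - omega \<gamma> t * \<tau>))
      + (log \<tau> (1 / (1 - omega \<gamma> t * \<tau>)) + 1 / ln \<tau>) / t"
    using scaled_s1_le[OF t al g] unfolding K_def by linarith
qed auto

lemma delta_tendsto_1: "delta \<longlonglongrightarrow> 1"
proof (rule order_tendstoI)
  fix a :: real assume "a < 1"
  show "\<forall>\<^sub>F t in sequentially. a < delta t"
    using eventually_ge_at_top[of 2] by eventually_elim (rule less_trans[OF \<open>a < 1\<close> delta_gt_1])
next
  fix a :: real assume a: "1 < a"
  \<comment> \<open>With \<open>\<gamma> = 1 + \<eta>\<close> and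
    \<open>\<tau> / (\<tau> - 1) = 1 + \<eta>\<close> the bound tends to
    \<open>(1 + \<eta>)^2\<close>, which is below \<open>1 + 3 * \<eta>\<close> and so below
    \<open>a\<close>.\<close>
  define \<eta> where "\<eta> = min 1 (a - 1) / 4"
  have \<eta>: "0 < \<eta>" "\<eta> < 1" "4 * \<eta> \<le> a - 1" using a by (auto simp: \<eta>_def)
  define \<gamma> where "\<gamma> = 1 + \<eta>"
  define \<tau> where "\<tau> = 1 + 1 / \<eta>"
  have g: "1 < \<gamma>" "1 < \<tau>" using \<eta> by (auto simp: \<gamma>_def \<tau>_def)
  have "\<gamma> * \<tau> / (\<tau> - 1) = (1 + \<eta>) * (1 + \<eta>)" using \<eta> by (simp add: \<gamma>_def \<tau>_def field_simps)
  also have "\<dots> < a"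
  proof -
    have "\<eta> * \<eta> < \<eta> * 1" using \<eta> by (intro mult_strict_left_mono) auto
    moreover have "(1 + \<eta>) * (1 + \<eta>) = 1 + 2 * \<eta> + \<eta> * \<eta>" by (simp add: algebra_simps)
    ultimately show ?thesis using \<eta> by linarith
  qed
  finally have lim_less: "\<gamma> * \<tau> / (\<tau> - 1) < a" .
  have o: "(\<lambda>t. omega \<gamma> t) \<longlonglongrightarrow> 0" by (rule omega_tendsto_0[OF g(1)])
  have K: "(\<lambda>t. 1 / (1 - omega \<gamma> t * \<tau>)) \<longlonglongrightarrow> 1 / (1 - 0 * \<tau>)"
    by (intro tendsto_intros o) simp
  have "(\<lambda>t. (\<gamma> * \<tau> / (\<tau> - 1)) * (1 / (1 - omega \<gamma> t * \<tau>))
      + (log \<tau> (1 / (1 - omega \<gamma> t * \<tau>)) + 1 / ln \<tau>) * (1 / real t)) \<longlonglongrightarrow>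
      (\<gamma> * \<tau> / (\<tau> - 1)) * (1 / (1 - 0 * \<tau>)) + (log \<tau> (1 / (1 - 0 * \<tau>)) + 1 / ln \<tau>) * 0"
    using g by (intro tendsto_add tendsto_mult tendsto_log tendsto_const K lim_1_over_n) auto
  then have "\<forall>\<^sub>F t in sequentially. (\<gamma> * \<tau> / (\<tau> - 1)) * (1 / (1 - omega \<gamma> t * \<tau>))
      + (log \<tau> (1 / (1 - omega \<gamma> t * \<tau>)) + 1 / ln \<tau>) * (1 / real t) < a"
    using lim_less by (intro order_tendstoD(2)) auto
  moreover have "\<forall>\<^sub>F t in sequentially. omega \<gamma> t < 1 / \<tau>"
    using o g by (intro order_tendstoD(2)) auto
  ultimately show "\<forall>\<^sub>F t in sequentially. delta t < a"
    using eventually_ge_at_top[of 2]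
  proof eventually_elim
    case (elim t)
    have "\<tau> * omega \<gamma> t < 1" using elim(2) g by (simp add: field_simps)
    then show ?case using delta_le_asymptotic[OF elim(3), of \<gamma> \<tau>] g elim(1) by simp
  qed
qed

section \<open>Committees within the infima\<close>

lemma exists_undominated_le_s1:
  assumes t: "2 \<le> t" and al: "0 < \<alpha>" "\<alpha> \<le> 1" and el: "election V A pref" and tA: "t \<le> card A"
  shows "\<exists>C. undominated V A pref t \<alpha> C \<and> card C \<le> s1 \<alpha> t"
proof -
  let ?P = "\<lambda>C. undominated V A pref t \<alpha> C"
  have "\<exists>C. ?P C"
    using undominated_many_rounds[OF t al el tA, of "7/2" 8] omega_seven_halves[OF t] by auto
  \<comment> \<open>No minimising parameters are needed: a smallest undominated set is bounded by
    every value in the set, hence by its infimum.\<close>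
  then obtain C where C: "?P C" "\<And>C'. ?P C' \<Longrightarrow> card C \<le> card C'"
    using ex_has_least_nat[of ?P _ card] by blast
  have "real (card C) \<le> s1 \<alpha> t"
  proof (rule s1_ge[OF t])
    fix \<gamma> \<tau> :: real
    assume h: "1 \<le> \<gamma>" "1 < \<tau>" "\<tau> * omega \<gamma> t < 1"
    obtain C' where "?P C'" and le: "real (card C') \<le> (\<gamma> * \<tau> / (\<tau> - 1)) * (1 / (1 - omega \<gamma> t * \<tau>)) * (t / \<alpha>)
                  + log \<tau> ((1 / (1 - omega \<gamma> t * \<tau>)) * (1 / \<alpha>))"
      using undominated_many_rounds[OF t al el tA h] by blast
    from C(2)[OF this(1)] have "real (card C) \<le> real (card C')" by simp
    then show "real (card C) \<le> (\<gamma> * \<tau> / (\<tau> - 1)) * (1 / (1 - omega \<gamma> t * \<tau>)) * (t / \<alpha>)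
                  + log \<tau> ((1 / (1 - omega \<gamma> t * \<tau>)) * (1 / \<alpha>))"
      using le by linarith
  qed
  then show ?thesis using C by blast
qed

lemma exists_undominated_le_s2:
  assumes t: "2 \<le> t" and al: "0 < \<alpha>" "\<alpha> \<le> 1" and el: "election V A pref" and tA: "t \<le> card A"
  shows "\<exists>C. undominated V A pref t \<alpha> C \<and> card C \<le> s2 \<alpha> t"
proof -
  obtain \<gamma>0 where "1 \<le> \<gamma>0" "omega \<gamma>0 t < \<alpha>" by (rule exists_omega_less[OF t al(1)])
  then obtain B and \<gamma> :: real where B: "s2 \<alpha> t = real B" "1 \<le> B" "1 \<le> \<gamma>" "\<gamma> * t / B + omega \<gamma> t \<le> \<alpha>"
    by (rule s2_attained[OF t])
  then show ?thesis
    using undominated_one_round[OF t al(2) el tA _ B(3,4)] by auto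
qed

theorem theorem2:
  fixes t :: nat and \<alpha> :: real
    and V :: "'v set" and A :: "'a set" and pref :: "'v \<Rightarrow> ('a \<times> 'a) set"
  assumes "t \<ge> 2" and "0 < \<alpha>" and "\<alpha> \<le> 1"
    and "election V A pref" and "card A \<ge> t"
  shows "(\<exists>C. undominated V A pref t \<alpha> C \<and> real (card C) \<le> of_int \<lfloor>delta t * t / \<alpha>\<rfloor>)
         \<and> 1 < delta t \<and> delta t \<le> 4.75
         \<and> (delta \<longlonglongrightarrow> 1)"
proof -
  have "\<alpha> / t * min (s1 \<alpha> t) (s2 \<alpha> t) = min (\<alpha> * s1 \<alpha> t / t) (\<alpha> * s2 \<alpha> t / t)"
    using assms by (subst min_mult_distrib_left) auto
  also have "\<dots> \<le> delta t" using assms by (intro le_delta) auto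
  finally have "min (s1 \<alpha> t) (s2 \<alpha> t) \<le> delta t * t / \<alpha>" using assms by (simp add: field_simps)
  moreover obtain C where C: "undominated V A pref t \<alpha> C" "card C \<le> min (s1 \<alpha> t) (s2 \<alpha> t)"
    using exists_undominated_le_s1[OF assms] exists_undominated_le_s2[OF assms]
    by (cases "s1 \<alpha> t \<le> s2 \<alpha> t") (auto simp: min_def)
  ultimately have "int (card C) \<le> \<lfloor>delta t * t / \<alpha>\<rfloor>" 
    unfolding le_floor_iff by linarith
  then have "real (card C) \<le> of_int \<lfloor>delta t * t / \<alpha>\<rfloor>" by linarith
  then show ?thesis
    using C(1) delta_gt_1[OF assms(1)] delta_le[OF assms(1)] delta_tendsto_1 by blast
qed

end
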